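(* Let $n\ge 2$ and $a\in\mathbb{B}_n$. The Berezin range $B(C_{\varphi_{a,-I}})$ of the composition operator $C_{\varphi_{a,-I}}$ on the Bergman space $A^2(\mathbb{B}_n)$ is convex if and only if $a=0$.
   Context: $\mathbb{B}_n$ is the open unit ball of $\mathbb{C}^n$ with the standard Hermitian inner product $\langle z,w\rangle=\sum_j z_j\overline{w_j}$ and norm $\|\cdot\|$. For $a\in\mathbb{B}_n$ put $s_a=(1-\|a\|^2)^{1/2}$, $P_a(z)=\frac{\langle z,a\rangle}{\|a\|^2}a$ if $a\ne0$, $P_0\equiv 0$, and $Q_a=I-P_a$. The automorphism $\varphi_{a,-I}$ of $\mathbb{B}_n$ is $\varphi_{a,-I}(z)=-\left(\frac{a-P_a(z)-s_aQ_a(z)}{1-\langle z,a\rangle}\right)$ (so $\varphi_{0,-I}(z)=z$). $A^2(\mathbb{B}_n)$ is the Bergman space of square-integrable (with respect to volume measure) holomorphic functions on $\mathbb{B}_n$, with the $L^2$ inner product, and $C_\varphi f=f\circ\varphi$. For $z\in\mathbb{B}_n$, $K_z$ is the Bergman (reproducing) kernel, $f(z)=\langle f,K_z\rangle$, namely $K_z(w)=\frac{n!}{\pi^n(1-\langle w,z\rangle)^{n+1}}$, and $k_z=K_z/\|K_z\|$. The Berezin transform of a bounded operator $T$ on $A^2(\mathbb{B}_n)$ is $\widetilde{T}(z)=\langle Tk_z,k_z\rangle$, and its Berezin range is $B(T)=\{\widetilde{T}(z):z\in\mathbb{B}_n\}\subset\mathbb{C}$. *)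

theory Defs
  imports "HOL-Analysis.Analysis"
begin

definition herm :: "complex ^ 'n \<Rightarrow> complex ^ 'n \<Rightarrow> complex" where
  "herm z w = (\<Sum>j\<in>UNIV. z $ j * cnj (w $ j))"

abbreviation unit_ball :: "(complex ^ 'n) set" where
  "unit_ball \<equiv> ball 0 1"

(* The library's holomorphic_on is restricted to functions of one complex variable;
   here the real Frechet derivative is required to be complex-linear. *)
definition holomorphic_several_on ::
    "(complex ^ 'n \<Rightarrow> complex) \<Rightarrow> (complex ^ 'n) set \<Rightarrow> bool" where
  "holomorphic_several_on f S \<longleftrightarrow>
     (\<forall>z\<in>S. \<exists>D. (f has_derivative D) (at z within S) \<and> (\<forall>c v. D (c *s v) = c * D v))"

(* Functions on the ball are represented by total functions whose values
   outside the ball are irrelevant. *)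
definition bergman_space :: "(complex ^ 'n \<Rightarrow> complex) set" where
  "bergman_space =
     {f. holomorphic_several_on f unit_ball \<and>
         set_integrable lborel unit_ball (\<lambda>w. (norm (f w))\<^sup>2)}"

definition bergman_inner ::
    "(complex ^ 'n \<Rightarrow> complex) \<Rightarrow> (complex ^ 'n \<Rightarrow> complex) \<Rightarrow> complex" where
  "bergman_inner f g = (LINT w:unit_ball|lborel. f w * cnj (g w))"

definition bergman_norm :: "(complex ^ 'n \<Rightarrow> complex) \<Rightarrow> real" where
  "bergman_norm f = sqrt (Re (bergman_inner f f))"

definition bergman_kernel :: "complex ^ 'n \<Rightarrow> complex ^ 'n \<Rightarrow> complex" where
  "bergman_kernel z w =
     of_real (fact CARD('n)) / (of_real (pi ^ CARD('n)) * (1 - herm w z) ^ (CARD('n) + 1))"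

definition normalized_kernel :: "complex ^ 'n \<Rightarrow> complex ^ 'n \<Rightarrow> complex" where
  "normalized_kernel z w = bergman_kernel z w / of_real (bergman_norm (bergman_kernel z))"

(* C_phi is an operator with domain the Bergman space. *)
definition composition_operator ::
    "(complex ^ 'n \<Rightarrow> complex ^ 'n) \<Rightarrow> (complex ^ 'n \<Rightarrow> complex) \<Rightarrow> complex ^ 'n \<Rightarrow> complex" where
  "composition_operator \<phi> = (\<lambda>f\<in>bergman_space. f \<circ> \<phi>)"

definition berezin_transform ::
    "((complex ^ 'n \<Rightarrow> complex) \<Rightarrow> complex ^ 'n \<Rightarrow> complex) \<Rightarrow> complex ^ 'n \<Rightarrow> complex" where
  "berezin_transform T z = bergman_inner (T (normalized_kernel z)) (normalized_kernel z)"

definition berezin_range ::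
    "((complex ^ 'n \<Rightarrow> complex) \<Rightarrow> complex ^ 'n \<Rightarrow> complex) \<Rightarrow> complex set" where
  "berezin_range T = berezin_transform T ` unit_ball"

definition proj_along :: "complex ^ 'n \<Rightarrow> complex ^ 'n \<Rightarrow> complex ^ 'n" where
  "proj_along a z = (if a = 0 then 0 else (herm z a / of_real ((norm a)\<^sup>2)) *s a)"

definition proj_perp :: "complex ^ 'n \<Rightarrow> complex ^ 'n \<Rightarrow> complex ^ 'n" where
  "proj_perp a z = z - proj_along a z"

(* The automorphism phi_{a,-I}, i.e. -I composed with the standard involution of the ball
   exchanging 0 and a. *)
definition ball_aut_neg :: "complex ^ 'n \<Rightarrow> complex ^ 'n \<Rightarrow> complex ^ 'n" where
  "ball_aut_neg a z =
     - ((1 / (1 - herm z a)) *s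
          (a - proj_along a z - complex_of_real (sqrt (1 - (norm a)\<^sup>2)) *s proj_perp a z))"

end

theory Submission
  imports Defs "HOL-Complex_Analysis.Cauchy_Integral_Formula" "HOL-Probability.Sinc_Integral"
begin

text \<open>
  By the reproducing property of the Bergman kernel, the Berezin transform at \<open>z\<close> is
  \<open>((1 - |z|\<^sup>2) / (1 - \<langle>\<phi>(z), z\<rangle>)) ^ (n + 1)\<close>, which never vanishes and equals 1 at the origin.
  On the complex line through \<open>a \<noteq> 0\<close> its values come in conjugate pairs, and since \<open>n + 1 \<ge> 3\<close> some
  of them have negative real part. If the range were convex, it would contain that real part,
  hence also 0.

  The reproducing property is needed only for powers of linear fractional functions, hence,
  after power series expansion, only for products of powers of linear forms. For these it is obtained
  from the Gaussian measure: translation of Lebesgue measure and the mean value property show that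
  \<open>exp \<langle>w, z\<rangle>\<close> reproduces with respect to \<open>exp (- |w|\<^sup>2)\<close>, and
  integration in polar form transfers the resulting moments to the ball.
\<close>

section \<open>Isometry invariance of Lebesgue measure\<close>

lemma nn_integral_lborel_translate:
  fixes f :: "'a::euclidean_space \<Rightarrow> ennreal"
  assumes [measurable]: "f \<in> borel_measurable borel"
  shows "(\<integral>\<^sup>+x. f (c + x) \<partial>lborel) = (\<integral>\<^sup>+x. f x \<partial>lborel)"
proof -
  have "(\<integral>\<^sup>+x. f x \<partial>lborel) = (\<integral>\<^sup>+x. f x \<partial>distr lborel borel ((+) c))"
    by (simp add: lborel_distr_plus)
  also have "\<dots> = (\<integral>\<^sup>+x. f (c + x) \<partial>lborel)"
    by (subst nn_integral_distr) auto
  finally show ?thesis ..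
qed

(* Uniqueness of Haar measure: both sides are translation invariant and agree on the unit ball. *)
lemma lborel_distr_linear_isometry:
  fixes T :: "'a::euclidean_space \<Rightarrow> 'a"
  assumes T: "linear T" and iso: "\<And>x. norm (T x) = norm x"
  shows "distr lborel borel T = lborel"
proof -
  let ?B = "indicator (ball (0::'a) 1) :: 'a \<Rightarrow> ennreal"
  have Bm [measurable]: "?B \<in> borel_measurable borel"
    by (intro borel_measurable_indicator borel_open open_ball)
  have contT: "continuous_on UNIV T"
    using T by (simp add: linear_continuous_on linear_conv_bounded_linear)
  have [measurable]: "T \<in> borel_measurable borel"
    using contT by (rule borel_measurable_continuous_onI)
  have "inj T"
    using T iso by (metis linear_injective_0 norm_eq_zero)
  then have "surj T"
    using T linear_injective_imp_surjective by blast
  then obtain S where S: "\<And>y. T (S y) = y"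
    by (metis surj_f_inv_f)
  have key: "(\<integral>\<^sup>+x. f (T x) \<partial>lborel) = (\<integral>\<^sup>+x. f x \<partial>lborel)"
    if [measurable]: "f \<in> borel_measurable borel" for f :: "'a \<Rightarrow> ennreal"
  proof -
    have "(\<integral>\<^sup>+x. f (T x) \<partial>lborel) * emeasure lborel (ball (0::'a) 1)
        = (\<integral>\<^sup>+x. (\<integral>\<^sup>+y. f (T x) * ?B y \<partial>lborel) \<partial>lborel)"
      by (subst nn_integral_cmult) (use Bm in \<open>auto simp: nn_integral_multc\<close>)
    also have "\<dots> = (\<integral>\<^sup>+x. (\<integral>\<^sup>+y. f (T x) * ?B (- T x + y) \<partial>lborel) \<partial>lborel)"
      by (intro nn_integral_cong nn_integral_lborel_translate[symmetric]) auto
    also have "\<dots> = (\<integral>\<^sup>+y. (\<integral>\<^sup>+x. f (T x) * ?B (- T x + y) \<partial>lborel) \<partial>lborel)"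
      by (rule lborel_pair.Fubini'[symmetric]) auto
    \<comment> \<open>Since \<open>T (S y) = y\<close>, shifting \<open>x\<close> by
      \<open>S y\<close> turns the argument of \<open>f\<close> into \<open>T x + y\<close> and that
      of the indicator into \<open>- T x\<close>. The centred ball only sees norms, so the indicator
      becomes \<open>?B x\<close> and the two integrals separate.\<close>
    also have "\<dots> = (\<integral>\<^sup>+y. (\<integral>\<^sup>+x. f (T (S y + x)) * ?B (- T (S y + x) + y) \<partial>lborel) \<partial>lborel)"
      by (intro nn_integral_cong
          nn_integral_lborel_translate[of "\<lambda>x. f (T x) * ?B (- T x + _)", symmetric]) auto
    also have "\<dots> = (\<integral>\<^sup>+y. (\<integral>\<^sup>+x. f (T x + y) * ?B x \<partial>lborel) \<partial>lborel)"
      by (intro nn_integral_cong)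
        (auto simp: linear_add[OF T] S iso indicator_def add.commute)
    also have "\<dots> = (\<integral>\<^sup>+x. (\<integral>\<^sup>+y. f (T x + y) * ?B x \<partial>lborel) \<partial>lborel)"
      by (rule lborel_pair.Fubini') auto
    also have "\<dots> = (\<integral>\<^sup>+x. (\<integral>\<^sup>+y. f y \<partial>lborel) * ?B x \<partial>lborel)"
      by (simp add: nn_integral_multc nn_integral_lborel_translate)
    also have "\<dots> = (\<integral>\<^sup>+x. f x \<partial>lborel) * emeasure lborel (ball (0::'a) 1)"
      by (simp add: nn_integral_cmult)
    finally have "emeasure lborel (ball (0::'a) 1) * (\<integral>\<^sup>+x. f (T x) \<partial>lborel)
        = emeasure lborel (ball (0::'a) 1) * (\<integral>\<^sup>+x. f x \<partial>lborel)"
      by (simp add: mult.commute)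
    moreover have "emeasure lborel (ball (0::'a) 1) \<noteq> 0"
      using content_ball_gt_0_iff[of "0::'a" 1] unfolding measure_def by auto
    moreover have "emeasure lborel (ball (0::'a) 1) \<noteq> top"
      using emeasure_lborel_ball_finite[of "0::'a" 1] by auto
    ultimately show ?thesis
      by (simp add: ennreal_mult_cancel_left)
  qed
  show ?thesis
  proof (rule measure_eqI)
    fix A assume A: "A \<in> sets (distr lborel borel T)"
    then have [measurable]: "A \<in> sets borel" by simp
    have "emeasure (distr lborel borel T) A = (\<integral>\<^sup>+x. indicator A x \<partial>distr lborel borel T)"
      by simp
    also have "\<dots> = (\<integral>\<^sup>+x. indicator A (T x) \<partial>lborel)"
      by (rule nn_integral_distr) simp_all
    also have "\<dots> = emeasure lborel A"
      by (subst key) auto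
    finally show "emeasure (distr lborel borel T) A = emeasure lborel A" .
  qed simp
qed

lemma integrable_lborel_linear_isometry_iff:
  fixes T :: "'a::euclidean_space \<Rightarrow> 'a" and f :: "'a \<Rightarrow> 'b::{banach, second_countable_topology}"
  assumes T: "linear T" "\<And>x. norm (T x) = norm x" and f: "f \<in> borel_measurable borel"
  shows "integrable lborel (\<lambda>x. f (T x)) \<longleftrightarrow> integrable lborel f"
proof -
  have "T \<in> borel_measurable borel"
    using T(1) by (intro borel_measurable_continuous_onI)
      (simp add: linear_continuous_on linear_conv_bounded_linear)
  then show ?thesis
    using integrable_distr_eq[of T lborel borel f] f lborel_distr_linear_isometry[OF T] by simp
qed

lemma integral_lborel_linear_isometry:
  fixes T :: "'a::euclidean_space \<Rightarrow> 'a" and f :: "'a \<Rightarrow> 'b::{banach, second_countable_topology}"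
  assumes T: "linear T" "\<And>x. norm (T x) = norm x" and f: "f \<in> borel_measurable borel"
  shows "(\<integral>x. f (T x) \<partial>lborel) = (\<integral>x. f x \<partial>lborel)"
proof -
  have "T \<in> borel_measurable borel"
    using T(1) by (intro borel_measurable_continuous_onI)
      (simp add: linear_continuous_on linear_conv_bounded_linear)
  then show ?thesis
    using integral_distr[of T lborel borel f] f lborel_distr_linear_isometry[OF T] by simp
qed

lemma integral_lborel_translate:
  fixes f :: "'a::euclidean_space \<Rightarrow> 'b::{banach, second_countable_topology}"
  assumes f: "f \<in> borel_measurable borel"
  shows "(\<integral>x. f (c + x) \<partial>lborel) = (\<integral>x. f x \<partial>lborel)"
  using integral_distr[of "(+) c" lborel borel f] f by (simp add: lborel_distr_plus)

section \<open>The Hermitian form\<close>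

lemma herm_add_left: "herm (x + y) z = herm x z + herm y z"
  and herm_add_right: "herm z (x + y) = herm z x + herm z y"
  and herm_diff_left: "herm (x - y) z = herm x z - herm y z"
  and herm_diff_right: "herm z (x - y) = herm z x - herm z y"
  and herm_minus_left: "herm (- x) z = - herm x z"
  and herm_scale_left: "herm (c *s x) z = c * herm x z"
  and herm_scale_right: "herm z (c *s x) = cnj c * herm z x"
  and herm_zero_left [simp]: "herm 0 z = 0"
  and herm_zero_right [simp]: "herm z 0 = 0"
  by (simp_all add: herm_def algebra_simps sum.distrib sum_subtractf sum_negf
      sum_distrib_left)

lemma cnj_herm: "cnj (herm x y) = herm y x"
  by (simp add: herm_def mult.commute)

lemma herm_self: "herm x x = of_real ((norm x)\<^sup>2)"
  by (simp add: herm_def norm_vec_def L2_set_def sum_nonneg flip: complex_norm_square)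

lemma norm_scale_vec: "norm (c *s (x :: complex ^ 'n)) = norm c * norm x"
  by (simp add: norm_vec_def norm_mult L2_set_right_distrib)

lemma cmod_herm_le: "cmod (herm x y) \<le> norm x * norm y"
proof -
  have "cmod (herm x y) \<le> (\<Sum>j\<in>UNIV. \<bar>cmod (x $ j)\<bar> * \<bar>cmod (y $ j)\<bar>)"
    unfolding herm_def by (rule order.trans[OF norm_sum]) (simp add: norm_mult)
  also have "\<dots> \<le> norm x * norm y"
    unfolding norm_vec_def by (rule L2_set_mult_ineq)
  finally show ?thesis .
qed

lemma linear_scale_vec: "linear (\<lambda>x :: complex ^ 'n. c *s x)"
  by (rule linearI) (simp_all add: vec_eq_iff algebra_simps)

lemma bounded_linear_herm: "bounded_linear (\<lambda>x. herm x y)"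
  by (rule bounded_linear_intro[of _ "norm y"])
    (simp_all add: herm_add_left cmod_herm_le, simp add: herm_def scaleR_sum_right)

lemma continuous_herm_left [continuous_intros]:
  "continuous_on A f \<Longrightarrow> continuous_on A (\<lambda>x. herm (f x) y)"
  by (rule bounded_linear.continuous_on[OF bounded_linear_herm])

lemma continuous_herm_right [continuous_intros]:
  "continuous_on A f \<Longrightarrow> continuous_on A (\<lambda>x. herm y (f x))"
  using continuous_on_cnj[OF continuous_herm_left[of A f y]] by (simp add: cnj_herm)

section \<open>Gaussian integrals\<close>

lemma integrable_lborel_scale_iff:
  fixes f :: "'a::euclidean_space \<Rightarrow> 'b::{banach, second_countable_topology}"
  assumes c: "c \<noteq> 0" and f [measurable]: "f \<in> borel_measurable borel"
  shows "integrable lborel (\<lambda>x. f (c *\<^sub>R x)) \<longleftrightarrow> integrable lborel f"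
proof -
  have "integrable lborel f \<longleftrightarrow>
      integrable (density (distr lborel borel ((*\<^sub>R) c)) (\<lambda>_. ennreal (\<bar>c\<bar> ^ DIM('a)))) f"
    by (subst lborel_affine[OF c, of 0]) simp
  also have "\<dots> \<longleftrightarrow> integrable (distr lborel borel ((*\<^sub>R) c)) (\<lambda>x. (\<bar>c\<bar> ^ DIM('a)) *\<^sub>R f x)"
    by (rule integrable_density) auto
  also have "\<dots> \<longleftrightarrow> integrable lborel (\<lambda>x. f (c *\<^sub>R x))"
    using c integrable_scaleR_right[of "inverse (\<bar>c\<bar> ^ DIM('a))" lborel "\<lambda>x. (\<bar>c\<bar> ^ DIM('a)) *\<^sub>R f (c *\<^sub>R x)"]
    by (subst integrable_distr_eq) auto
  finally show ?thesis ..
qed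

lemma integral_lborel_scale:
  fixes f :: "'a::euclidean_space \<Rightarrow> 'b::{banach, second_countable_topology}"
  assumes c: "c \<noteq> 0" and f [measurable]: "f \<in> borel_measurable borel"
  shows "(\<integral>x. f x \<partial>lborel) = (\<bar>c\<bar> ^ DIM('a)) *\<^sub>R (\<integral>x. f (c *\<^sub>R x) \<partial>lborel)"
proof -
  have "(\<integral>x. f x \<partial>lborel) =
      (\<integral>x. f x \<partial>density (distr lborel borel ((*\<^sub>R) c)) (\<lambda>_. ennreal (\<bar>c\<bar> ^ DIM('a))))"
    by (subst lborel_affine[OF c, of 0]) simp
  also have "\<dots> = (\<integral>x. (\<bar>c\<bar> ^ DIM('a)) *\<^sub>R f x \<partial>distr lborel borel ((*\<^sub>R) c))"
    by (rule integral_density) auto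
  also have "\<dots> = (\<bar>c\<bar> ^ DIM('a)) *\<^sub>R (\<integral>x. f (c *\<^sub>R x) \<partial>lborel)"
    by (subst integral_distr) auto
  finally show ?thesis .
qed

(* Layer cake for exp (-|w|^2) = \<integral> s > |w|^2. exp (-s), with the ball of radius sqrt s
   rescaled to the unit ball. *)
lemma integral_gauss_homogeneous:
  fixes F :: "complex ^ 'n \<Rightarrow> complex"
  assumes F [measurable]: "F \<in> borel_measurable borel"
    and hom: "\<And>t w. 0 < t \<Longrightarrow> F (t *\<^sub>R w) = of_real (t ^ (2 * k)) * F w"
    and int: "set_integrable lborel unit_ball F"
  shows "integrable lborel (\<lambda>w. F w * of_real (exp (- (norm w)\<^sup>2)))" (is ?int)
    and "(\<integral>w. F w * of_real (exp (- (norm w)\<^sup>2)) \<partial>lborel)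
      = of_real (fact (CARD('n) + k)) * (LINT w:unit_ball|lborel. F w)" (is ?eq)
proof -
  let ?n = "CARD('n)"
  define H where "H s w = indicator {w. (norm w)\<^sup>2 < s} w * of_real (exp (- s)) * F w"
    for s :: real and w
  have Hm: "(\<lambda>(s, w). H s w) \<in> borel_measurable (lborel \<Otimes>\<^sub>M lborel)"
    unfolding H_def indicator_def by measurable
  have dim: "DIM(complex ^ 'n) = 2 * ?n"
    by simp
  have nonpos: "H s w = 0" if "s \<le> 0" for s w
    using that by (auto simp: H_def indicator_def)
      (meson le_less_trans not_less zero_le_power2)
  \<comment> \<open>Rescaling by \<open>sqrt s\<close> separates the variables: the cutoff becomes
    the unit ball, and homogeneity of real degree \<open>2 * k\<close> yields
    \<open>s ^ k\<close>.\<close>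
  have scaled: "H s (sqrt s *\<^sub>R w) = of_real (s ^ k * exp (- s)) * (indicator unit_ball w *\<^sub>R F w)"
    if "s > 0" for s w
  proof -
    have "(norm (sqrt s *\<^sub>R w))\<^sup>2 < s \<longleftrightarrow> (norm w)\<^sup>2 < 1"
      using that by (simp add: power_mult_distrib)
    moreover have "(norm w)\<^sup>2 < 1 \<longleftrightarrow> norm w < 1"
      by (metis abs_norm_cancel abs_square_less_1)
    moreover have "sqrt s ^ (2 * k) = s ^ k"
      using that by (simp add: power_mult)
    ultimately show ?thesis
      using that hom[of "sqrt s" w] by (auto simp: H_def indicator_def)
  qed
  have Hs: "H s \<in> borel_measurable borel" for s
    unfolding H_def indicator_def by measurable
  have int_s: "integrable lborel (H s)" for s
  proof (cases "s > 0")
    case True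
    have "integrable lborel (\<lambda>w. H s (sqrt s *\<^sub>R w))"
      using int unfolding scaled[OF True] set_integrable_def by (rule integrable_mult_right)
    then show ?thesis
      using True Hs by (subst (asm) integrable_lborel_scale_iff) auto
  next
    case False
    then have "H s = (\<lambda>_. 0)"
      using nonpos by auto
    then show ?thesis
      by simp
  qed
  \<comment> \<open>A general positively homogeneous \<open>g\<close> covers two uses: the norm, for
    integrability on the product, and the identity, for the value. The rescaling acts in real
    dimension \<open>2 * ?n\<close>, which adds the factor \<open>s ^ ?n\<close>.\<close>
  have nrm: "(\<integral>w. g (H s w) \<partial>lborel) = (s ^ (?n + k) * exp (- s) * indicator {0<..} s)
        *\<^sub>R (\<integral>w. g (indicator unit_ball w *\<^sub>R F w) \<partial>lborel)"
    if g: "g \<in> borel_measurable borel" "g 0 = 0"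
      "\<And>c z. 0 \<le> c \<Longrightarrow> g (of_real c * z) = c *\<^sub>R g z"
    for g :: "complex \<Rightarrow> 'b::{banach, second_countable_topology}" and s
  proof (cases "s > 0")
    case True
    have "(\<integral>w. g (H s w) \<partial>lborel) = (\<bar>sqrt s\<bar> ^ DIM(complex ^ 'n)) *\<^sub>R (\<integral>w. g (H s (sqrt s *\<^sub>R w)) \<partial>lborel)"
      using True Hs g(1) by (intro integral_lborel_scale) auto
    also have "\<bar>sqrt s\<bar> ^ DIM(complex ^ 'n) = s ^ ?n"
      using True by (simp only: dim) (simp add: power_mult)
    also have "(\<integral>w. g (H s (sqrt s *\<^sub>R w)) \<partial>lborel)
        = (s ^ k * exp (- s)) *\<^sub>R (\<integral>w. g (indicator unit_ball w *\<^sub>R F w) \<partial>lborel)"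
      unfolding scaled[OF True] using True by (subst g(3)) auto
    finally show ?thesis
      using True by (simp add: power_add)
  next
    case False
    then show ?thesis
      using nonpos[of s] g(2) by simp
  qed
  \<comment> \<open>This Gamma integral is the source of the factorial in the conclusion.\<close>
  have gam: "has_bochner_integral lborel (\<lambda>s. s ^ (?n + k) * exp (- s) * indicator {0<..} s :: real)
      (fact (?n + k))"
    by (rule has_bochner_integral_I0i_power_exp_m)
  have prod: "integrable (lborel \<Otimes>\<^sub>M lborel) (\<lambda>(s, w). H s w)"
  proof (rule lborel_pair.Fubini_integrable)
    show "integrable lborel (\<lambda>s. \<integral>w. norm (case (s, w) of (s, w) \<Rightarrow> H s w) \<partial>lborel)"
      unfolding prod.case
      using has_bochner_integral_integrable gam integrable.intros[OF gam]
      by (subst nrm) (auto simp: norm_mult)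
  qed (use Hm int_s in auto)
  have inner: "(\<integral>s. H s w \<partial>lborel) = F w * of_real (exp (- (norm w)\<^sup>2))" for w
  proof -
    let ?r = "(norm w)\<^sup>2"
    \<comment> \<open>Shifting \<open>s\<close> by \<open>?r\<close> moves the support to the
      positive half-line and splits off the Gaussian factor.\<close>
    have "(\<integral>s. H s w \<partial>lborel) = (\<integral>s. H (?r + s) w \<partial>lborel)"
      by (rule integral_lborel_translate[symmetric]) (simp add: H_def indicator_def)
    also have "\<dots> = (\<integral>s. (exp (- s) * indicator {0<..} s) *\<^sub>R (of_real (exp (- ?r)) * F w) \<partial>lborel)"
      by (intro Bochner_Integration.integral_cong)
        (auto simp: H_def indicator_def mult_exp_exp scaleR_conv_of_real simp flip: of_real_mult)
    also have "\<dots> = F w * of_real (exp (- ?r))"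
      using has_bochner_integral_I0i_power_exp_m[of 0]
      by (subst integral_scaleR_left) (auto simp: has_bochner_integral_iff)
    finally show ?thesis .
  qed
  show ?int
    using lborel_pair.integrable_snd[OF prod] unfolding inner .
  have "(\<integral>w. F w * of_real (exp (- (norm w)\<^sup>2)) \<partial>lborel) = (\<integral>s. (\<integral>w. H s w \<partial>lborel) \<partial>lborel)"
    unfolding inner[symmetric] by (rule lborel_pair.Fubini_integral) (rule prod)
  also have "\<dots> = (\<integral>s. (s ^ (?n + k) * exp (- s) * indicator {0<..} s) *\<^sub>R
      (LINT w:unit_ball|lborel. F w) \<partial>lborel)"
    using nrm[of "\<lambda>x. x"] by (simp add: scaleR_conv_of_real set_lebesgue_integral_def)
  also have "\<dots> = fact (?n + k) *\<^sub>R (LINT w:unit_ball|lborel. F w)"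
    using has_bochner_integral_integral_eq[OF gam] integrable.intros[OF gam]
    by (subst integral_scaleR_left) auto
  finally show ?eq
    by (simp add: scaleR_conv_of_real)
qed

section \<open>Mean values and reproduction for the Gaussian measure\<close>

text \<open>Cauchy's integral formula on the unit circle. The derivative of the parametrisation
  contributes \<open>2 * pi * \<i>\<close> times the point itself, which cancels both the constant
  and the denominator of the formula.\<close>

lemma circle_mean_value:
  fixes f :: "complex \<Rightarrow> complex"
  assumes f: "f holomorphic_on UNIV"
  shows "(LINT t:{0..1}|lborel. f (exp (2 * of_real pi * \<i> * of_real t))) = f 0"
proof -
  let ?e = "\<lambda>t::real. exp (2 * of_real pi * \<i> * of_real t)"
  have cont: "continuous_on {0..1} (\<lambda>t. f (?e t))"
    by (rule continuous_on_compose2[OF holomorphic_on_imp_continuous_on[OF f]])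
      (auto intro!: continuous_intros)
  have "((\<lambda>u. f u / (u - 0)) has_contour_integral (2 * of_real pi * \<i> * f 0)) (circlepath 0 1)"
    using f by (intro Cauchy_integral_circlepath_simple) (auto intro: holomorphic_on_subset)
  then have "((\<lambda>t. f (?e t) / ?e t * (2 * of_real pi * \<i> * ?e t))
      has_integral (2 * of_real pi * \<i> * f 0)) {0..1}"
    unfolding has_contour_integral_def
    by (rule has_integral_eq[rotated])
      (simp add: vector_derivative_circlepath01, simp add: circlepath)
  then have "((\<lambda>t. (2 * of_real pi * \<i>) * f (?e t)) has_integral ((2 * of_real pi * \<i>) * f 0)) {0..1}"
    by (simp add: mult_ac)
  from has_integral_mult_right[OF this, of "inverse (2 * of_real pi * \<i>)"]
  have "((\<lambda>t. f (?e t)) has_integral f 0) {0..1}"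
    by (simp add: field_simps)
  moreover have "set_integrable lborel {0..1} (\<lambda>t. f (?e t))"
    using cont by (rule borel_integrable_atLeastAtMost')
  ultimately show ?thesis
    using set_borel_integral_eq_integral(2) integral_unique by metis
qed

lemma continuous_on_scale_vec [continuous_intros]:
  fixes g :: "'a::topological_space \<Rightarrow> complex ^ 'n"
  assumes "continuous_on A f" "continuous_on A g"
  shows "continuous_on A (\<lambda>x. f x *s g x)"
  unfolding vector_scalar_mult_def using assms by (intro continuous_intros)

text \<open>The homogeneous case with \<open>F = 1\<close> and \<open>k = 0\<close>. The volume of
  the ball stays a symbol; it cancels in the Berezin transform.\<close>

lemma integral_gauss:
  "(\<integral>w. complex_of_real (exp (- (norm (w :: complex ^ 'n))\<^sup>2)) \<partial>lborel)
    = of_real (fact CARD('n) * measure lborel (unit_ball :: (complex ^ 'n) set))"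
  and integrable_gauss: "integrable lborel (\<lambda>w :: complex ^ 'n. exp (- (norm w)\<^sup>2))"
proof -
  have "set_integrable lborel (unit_ball :: (complex ^ 'n) set) (\<lambda>_. 1 :: complex)"
    unfolding set_integrable_def using emeasure_lborel_ball_finite[of 0 1]
    by (intro integrable_scaleR_left integrable_real_indicator) auto
  note gauss = integral_gauss_homogeneous[where F = "\<lambda>_ :: complex ^ 'n. 1" and k = 0, simplified, OF this]
  show "(\<integral>w. complex_of_real (exp (- (norm (w :: complex ^ 'n))\<^sup>2)) \<partial>lborel)
      = of_real (fact CARD('n) * measure lborel (unit_ball :: (complex ^ 'n) set))"
    using gauss(2) by (simp add: set_lebesgue_integral_def scaleR_conv_of_real)
  show "integrable lborel (\<lambda>w :: complex ^ 'n. exp (- (norm w)\<^sup>2))"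
    using gauss(1) by (simp add: complex_of_real_integrable_eq)
qed

lemma integrable_gauss_growth:
  fixes h :: "complex ^ 'n \<Rightarrow> complex"
  assumes h [measurable]: "h \<in> borel_measurable borel"
    and bound: "\<And>w. cmod (h w) \<le> C * exp (B * norm w)"
  shows "integrable lborel (\<lambda>w. h w * of_real (exp (- (norm w)\<^sup>2)))"
proof (rule Bochner_Integration.integrable_bound)
  have "integrable lborel (\<lambda>w :: complex ^ 'n. exp (- (norm ((1 / sqrt 2) *\<^sub>R w))\<^sup>2))"
    by (subst integrable_lborel_scale_iff) (auto intro: integrable_gauss)
  then show "integrable lborel (\<lambda>w :: complex ^ 'n. C * exp (B\<^sup>2 / 2) * exp (- (norm w)\<^sup>2 / 2))"
    by (auto simp: power_divide)
  show "AE w in lborel. norm (h w * of_real (exp (- (norm w)\<^sup>2)))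
      \<le> norm (C * exp (B\<^sup>2 / 2) * exp (- (norm w)\<^sup>2 / 2))"
  proof (rule AE_I2)
    fix w :: "complex ^ 'n"
    have "0 \<le> C"
      using order_trans[OF norm_ge_zero bound[of 0]] by simp
    \<comment> \<open>Completing the square: half of the Gaussian decay absorbs the exponential
      growth, at the price of the constant \<open>exp (B\<^sup>2 / 2)\<close>.\<close>
    have "0 \<le> (norm w - B)\<^sup>2 / 2"
      by simp
    then have *: "B * norm w + - (norm w)\<^sup>2 \<le> B\<^sup>2 / 2 + - (norm w)\<^sup>2 / 2"
      unfolding power2_diff by (simp add: field_simps)
    have "norm (h w * of_real (exp (- (norm w)\<^sup>2))) \<le> C * exp (B * norm w) * exp (- (norm w)\<^sup>2)"
      using bound[of w] by (simp add: norm_mult mult_right_mono)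
    also have "\<dots> = C * exp (B * norm w + - (norm w)\<^sup>2)"
      by (simp only: exp_add mult.assoc)
    also have "\<dots> \<le> C * exp (B\<^sup>2 / 2 + - (norm w)\<^sup>2 / 2)"
      using * \<open>0 \<le> C\<close> by (intro mult_left_mono) simp_all
    also have "\<dots> \<le> norm (C * exp (B\<^sup>2 / 2) * exp (- (norm w)\<^sup>2 / 2))"
      unfolding exp_add using \<open>0 \<le> C\<close> by simp
    finally show "norm (h w * of_real (exp (- (norm w)\<^sup>2)))
      \<le> norm (C * exp (B\<^sup>2 / 2) * exp (- (norm w)\<^sup>2 / 2))" .
  qed
qed measurable

text \<open>Multiplication by a scalar of modulus 1 preserves both Lebesgue measure and the weight,
  so \<open>h\<close> may first be averaged over such rotations. On each complex line through 0 this
  average is \<open>h 0\<close> by the mean value property in one variable.\<close>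

lemma gauss_mean_value:
  fixes h :: "complex ^ 'n \<Rightarrow> complex"
  assumes cont: "continuous_on UNIV h"
    and hol: "\<And>w. (\<lambda>c. h (c *s w)) holomorphic_on UNIV"
    and bound: "\<And>w. cmod (h w) \<le> C * exp (B * norm w)"
  shows "(\<integral>w. h w * of_real (exp (- (norm w)\<^sup>2)) \<partial>lborel)
    = h 0 * (\<integral>w. of_real (exp (- (norm (w :: complex ^ 'n))\<^sup>2)) \<partial>lborel)"
proof -
  have hm [measurable]: "h \<in> borel_measurable borel"
    using cont by (rule borel_measurable_continuous_onI)
  define e where "e t = exp (2 * of_real pi * \<i> * of_real t)" for t :: real
  have e1: "cmod (e t) = 1" for t
    by (simp add: e_def)
  define f where "f w = h w * of_real (exp (- (norm w)\<^sup>2))" for w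
  have f_cont: "continuous_on UNIV f"
    unfolding f_def by (intro continuous_intros cont)
  then have fm [measurable]: "f \<in> borel_measurable borel"
    by (rule borel_measurable_continuous_onI)
  have f_int: "integrable lborel f"
    unfolding f_def using hm bound by (rule integrable_gauss_growth)
  define H where "H t w = indicator {0..1} t *\<^sub>R f (e t *s w)" for t w
  have "continuous_on UNIV (\<lambda>x :: real \<times> (complex ^ 'n). f (e (fst x) *s snd x))"
    unfolding e_def by (rule continuous_on_compose2[OF f_cont]) (auto intro!: continuous_intros)
  then have [measurable]: "(\<lambda>x. f (e (fst x) *s snd x)) \<in> borel_measurable (lborel \<Otimes>\<^sub>M lborel)"
    using borel_measurable_continuous_onI by (simp add: lborel_prod)
  have Hm: "(\<lambda>(t, w). H t w) \<in> borel_measurable (lborel \<Otimes>\<^sub>M lborel)"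
    unfolding H_def case_prod_beta by measurable
  have iso: "linear (\<lambda>w :: complex ^ 'n. e t *s w)" "norm (e t *s w) = norm w" for t and w :: "complex ^ 'n"
    by (simp_all add: linear_scale_vec norm_scale_vec e1)
  have rot: "(\<integral>w. g (e t *s w) \<partial>lborel) = (\<integral>w. g w \<partial>lborel)" if "g \<in> borel_measurable borel"
    for g :: "complex ^ 'n \<Rightarrow> 'b::{banach, second_countable_topology}" and t
    using integral_lborel_linear_isometry[OF iso] that .
  have prod: "integrable (lborel \<Otimes>\<^sub>M lborel) (\<lambda>(t, w). H t w)"
  proof (rule lborel_pair.Fubini_integrable)
    have "(\<integral>w. norm (H t w) \<partial>lborel) = indicator {0..1} t * (\<integral>w. norm (f w) \<partial>lborel)" for t
      using rot[of "\<lambda>w. norm (f w)" t] by (simp add: H_def)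
    then show "integrable lborel (\<lambda>t. \<integral>w. norm (case (t, w) of (t, w) \<Rightarrow> H t w) \<partial>lborel)"
      by simp
    show "AE t in lborel. integrable lborel (\<lambda>w. case (t, w) of (t, w) \<Rightarrow> H t w)"
      using f_int by (simp add: H_def integrable_lborel_linear_isometry_iff[OF iso fm])
  qed (rule Hm)
  have inner: "(\<integral>t. H t w \<partial>lborel) = h 0 * of_real (exp (- (norm w)\<^sup>2))" for w
  proof -
    have "(\<integral>t. H t w \<partial>lborel) = (LINT t:{0..1}|lborel. h (e t *s w)) * of_real (exp (- (norm w)\<^sup>2))"
      by (simp add: H_def f_def iso set_lebesgue_integral_def flip: integral_mult_left_zero)
    also have "(LINT t:{0..1}|lborel. h (e t *s w)) = h 0"
      using circle_mean_value[OF hol[of w]] by (simp add: e_def)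
    finally show ?thesis .
  qed
  have "(\<integral>w. h w * of_real (exp (- (norm w)\<^sup>2)) \<partial>lborel)
      = (\<integral>t. indicator {0..1} t *\<^sub>R (\<integral>w. f w \<partial>lborel) \<partial>(lborel :: real measure))"
    by (simp add: f_def)
  also have "\<dots> = (\<integral>t. (\<integral>w. H t w \<partial>lborel) \<partial>lborel)"
    by (simp add: H_def rot)
  also have "\<dots> = (\<integral>w. (\<integral>t. H t w \<partial>lborel) \<partial>lborel)"
    by (rule lborel_pair.Fubini_integral[symmetric]) (rule prod)
  finally show ?thesis
    by (simp add: inner)
qed

(* Translating by z turns exp (herm z w) into exp (- herm w z), which is holomorphic in w. *)
lemma gauss_reproducing:
  fixes p :: "complex ^ 'n \<Rightarrow> complex"
  assumes cont: "continuous_on UNIV p"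
    and hol: "\<And>z w. (\<lambda>c. p (z + c *s w)) holomorphic_on UNIV"
    and bound: "\<And>w. cmod (p w) \<le> C * exp (B * norm w)" and B: "0 \<le> B"
  shows "(\<integral>w. p w * exp (herm z w) * of_real (exp (- (norm w)\<^sup>2)) \<partial>lborel)
    = p z * (\<integral>w. of_real (exp (- (norm (w :: complex ^ 'n))\<^sup>2)) \<partial>lborel)"
proof -
  define h where "h w = p (z + w) * exp (- herm w z)" for w
  have "0 \<le> C"
    using order_trans[OF norm_ge_zero bound[of 0]] by simp
  have "(\<integral>w. p w * exp (herm z w) * of_real (exp (- (norm w)\<^sup>2)) \<partial>lborel)
      = (\<integral>w. p (z + w) * exp (herm z (z + w)) * of_real (exp (- (norm (z + w))\<^sup>2)) \<partial>lborel)"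
    by (rule integral_lborel_translate[symmetric])
      (intro borel_measurable_continuous_onI continuous_intros cont)
  also have "\<dots> = (\<integral>w. h w * of_real (exp (- (norm w)\<^sup>2)) \<partial>lborel)"
  proof (intro Bochner_Integration.integral_cong refl)
    fix w
    have "exp (herm z (z + w)) * of_real (exp (- (norm (z + w))\<^sup>2))
        = exp (herm z (z + w) - herm (z + w) (z + w))"
      by (simp add: herm_self exp_diff exp_minus divide_inverse flip: exp_of_real)
    also have "herm z (z + w) - herm (z + w) (z + w) = - herm w z + - of_real ((norm w)\<^sup>2)"
      unfolding herm_add_left herm_add_right by (simp add: herm_self)
    also have "exp \<dots> = exp (- herm w z) * of_real (exp (- (norm w)\<^sup>2))"
      by (simp only: exp_add) (simp flip: exp_of_real)
    finally show "p (z + w) * exp (herm z (z + w)) * of_real (exp (- (norm (z + w))\<^sup>2))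
        = h w * of_real (exp (- (norm w)\<^sup>2))"
      by (simp add: h_def mult.assoc)
  qed
  also have "\<dots> = h 0 * (\<integral>w. of_real (exp (- (norm (w :: complex ^ 'n))\<^sup>2)) \<partial>lborel)"
  proof (rule gauss_mean_value)
    show "continuous_on UNIV h"
      unfolding h_def
      by (intro continuous_intros continuous_on_compose2[OF cont]) auto
    show "(\<lambda>c. h (c *s w)) holomorphic_on UNIV" for w
      unfolding h_def herm_scale_left by (intro holomorphic_intros hol)
    show "cmod (h w) \<le> (C * exp (B * norm z)) * exp ((B + norm z) * norm w)" for w
    proof -
      have "cmod (p (z + w)) \<le> C * exp (B * norm (z + w))"
        by (rule bound)
      also have "\<dots> \<le> C * exp (B * norm z + B * norm w)"
        using \<open>0 \<le> C\<close> B mult_left_mono[OF norm_triangle_ineq[of z w] B]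
        by (intro mult_left_mono) (simp_all add: algebra_simps)
      finally have "cmod (p (z + w)) \<le> C * exp (B * norm z + B * norm w)" .
      moreover have "cmod (exp (- herm w z)) \<le> exp (norm z * norm w)"
        using abs_Re_le_cmod[of "herm w z"] cmod_herm_le[of w z]
        by (simp add: mult.commute)
      ultimately have "cmod (h w) \<le> C * exp (B * norm z + B * norm w) * exp (norm z * norm w)"
        unfolding h_def norm_mult using \<open>0 \<le> C\<close> by (intro mult_mono) auto
      then show ?thesis
        by (simp add: exp_add algebra_simps)
    qed
  qed
  finally show ?thesis
    by (simp add: h_def)
qed

section \<open>Orthogonality under rotations and Gaussian moments\<close>

text \<open>Rotation by the angle \<open>pi / (k - j)\<close> preserves Lebesgue measure and
  multiplies \<open>F\<close> by -1, so the integral equals its own negative.\<close>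

lemma integral_rotation_eq_0:
  fixes F :: "complex ^ 'n \<Rightarrow> complex"
  assumes F: "F \<in> borel_measurable borel"
    and rot: "\<And>c w. cmod c = 1 \<Longrightarrow> F (c *s w) = c ^ k * cnj c ^ j * F w"
    and "j \<noteq> k"
  shows "(\<integral>w. F w \<partial>lborel) = 0"
proof -
  define x where "x = pi / (real k - real j)"
  define c where "c = cis x"
  have "c ^ k * cnj c ^ j = cis (real k * x + - real j * x)"
    unfolding c_def cis_cnj Complex.DeMoivre cis_mult by simp
  also have "real k * x + - real j * x = (real k - real j) * x"
    by (simp add: algebra_simps)
  also have "\<dots> = pi"
    using \<open>j \<noteq> k\<close> by (simp add: x_def)
  finally have c: "c ^ k * cnj c ^ j = - 1"
    by simp
  have c1: "cmod c = 1"
    by (simp add: c_def)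
  have "(\<integral>w. F w \<partial>lborel) = (\<integral>w. F (c *s w) \<partial>lborel)"
    using F by (intro integral_lborel_linear_isometry[symmetric] linear_scale_vec)
      (simp_all add: norm_scale_vec c1)
  also have "\<dots> = - (\<integral>w. F w \<partial>lborel)"
    unfolding rot[OF c1] c by simp
  finally show ?thesis
    by simp
qed

lemma norm_sum_exp_le:
  fixes x :: complex
  shows "cmod (\<Sum>j<N. x ^ j / fact j) \<le> exp (cmod x)"
proof -
  have "cmod (\<Sum>j<N. x ^ j / fact j) \<le> (\<Sum>j<N. inverse (fact j) *\<^sub>R cmod x ^ j)"
    by (rule sum_norm_le) (simp add: norm_mult norm_inverse norm_power divide_inverse mult.commute)
  also have "\<dots> \<le> exp (cmod x)"
    unfolding exp_def by (rule sum_le_suminf[OF summable_exp_generic]) auto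
  finally show ?thesis .
qed

lemma power_le_fact_exp:
  fixes x :: real
  assumes "0 \<le> x"
  shows "x ^ k \<le> fact k * exp x"
proof -
  have "(\<Sum>j\<in>{k}. inverse (fact j) *\<^sub>R x ^ j) \<le> exp x"
    unfolding exp_def by (rule sum_le_suminf[OF summable_exp_generic]) (use assms in auto)
  then show ?thesis
    by (simp add: field_simps)
qed

lemma norm_herm_monomial_le:
  "cmod (herm w u ^ m * herm w a ^ i) \<le> (norm u ^ m * norm a ^ i) * norm w ^ (m + i)"
proof -
  have "cmod (herm w u ^ m * herm w a ^ i) \<le> (norm w * norm u) ^ m * (norm w * norm a) ^ i"
    unfolding norm_mult norm_power by (intro mult_mono power_mono cmod_herm_le) auto
  then show ?thesis
    by (simp add: power_mult_distrib power_add mult_ac)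
qed

text \<open>The exponential in \<open>gauss_reproducing\<close> is expanded into its power series
  and integrated termwise. By rotation only the term of degree \<open>m + i\<close> survives, and it
  carries the coefficient \<open>1 / fact (m + i)\<close>.\<close>

lemma gauss_moment:
  fixes z u a :: "complex ^ 'n" and m i :: nat
  defines "p \<equiv> \<lambda>w. herm w u ^ m * herm w a ^ i"
  shows "(\<integral>w. p w * herm z w ^ (m + i) * of_real (exp (- (norm w)\<^sup>2)) \<partial>lborel)
    = fact (m + i) * p z * (\<integral>w. of_real (exp (- (norm (w :: complex ^ 'n))\<^sup>2)) \<partial>lborel)"
    (is "?M (m + i) = _ * ?G")
proof -
  let ?k = "m + i" and ?\<gamma> = "\<lambda>w :: complex ^ 'n. complex_of_real (exp (- (norm w)\<^sup>2))"
  define C where "C = norm u ^ m * norm a ^ i * fact ?k"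
  have cont: "continuous_on UNIV p"
    unfolding p_def by (intro continuous_intros)
  have bound: "cmod (p w) \<le> C * exp (1 * norm w)" for w
  proof -
    have "cmod (p w) \<le> (norm u ^ m * norm a ^ i) * norm w ^ ?k"
      unfolding p_def by (rule norm_herm_monomial_le)
    also have "\<dots> \<le> (norm u ^ m * norm a ^ i) * (fact ?k * exp (norm w))"
      by (intro mult_left_mono power_le_fact_exp) auto
    finally show ?thesis
      by (simp add: C_def mult_ac)
  qed
  have "0 \<le> C"
    by (simp add: C_def)
  have total: "(\<integral>w. p w * exp (herm z w) * ?\<gamma> w \<partial>lborel) = p z * ?G"
  proof (rule gauss_reproducing[OF cont _ bound])
    show "(\<lambda>c. p (z + c *s w)) holomorphic_on UNIV" for z w
      unfolding p_def herm_add_left herm_scale_left by (intro holomorphic_intros)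
  qed simp
  have term_int: "integrable lborel (\<lambda>w. p w * herm z w ^ j * ?\<gamma> w)" for j
  proof (rule integrable_gauss_growth)
    show "(\<lambda>w. p w * herm z w ^ j) \<in> borel_measurable borel"
      by (intro borel_measurable_continuous_onI continuous_intros cont)
    show "cmod (p w * herm z w ^ j) \<le> (C * fact j) * exp ((1 + norm z) * norm w)" for w
    proof -
      have "cmod (herm z w ^ j) \<le> (norm z * norm w) ^ j"
        unfolding norm_power by (intro power_mono cmod_herm_le) simp
      also have "\<dots> \<le> fact j * exp (norm z * norm w)"
        by (rule power_le_fact_exp) simp
      finally have "cmod (p w * herm z w ^ j)
          \<le> (C * exp (1 * norm w)) * (fact j * exp (norm z * norm w))"
        unfolding norm_mult using \<open>0 \<le> C\<close> by (intro mult_mono bound) auto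
      also have "\<dots> = (C * fact j) * exp ((1 + norm z) * norm w)"
        by (simp add: exp_add algebra_simps)
      finally show ?thesis .
    qed
  qed
  have zero: "?M j = 0" if "j \<noteq> ?k" for j
  proof (rule integral_rotation_eq_0[OF _ _ that])
    show "(\<lambda>w. p w * herm z w ^ j * ?\<gamma> w) \<in> borel_measurable borel"
      by (intro borel_measurable_continuous_onI continuous_intros cont)
    show "p (c *s w) * herm z (c *s w) ^ j * ?\<gamma> (c *s w) = c ^ ?k * cnj c ^ j * (p w * herm z w ^ j * ?\<gamma> w)"
      if "cmod c = 1" for c w
      using that by (simp add: p_def herm_scale_left herm_scale_right norm_scale_vec
          power_mult_distrib power_add)
  qed
  define s where "s N w = p w * (\<Sum>j<N. herm z w ^ j / fact j) * ?\<gamma> w" for N w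
  have "(\<lambda>N. \<integral>w. s N w \<partial>lborel) \<longlonglongrightarrow> (\<integral>w. p w * exp (herm z w) * ?\<gamma> w \<partial>lborel)"
  proof (rule integral_dominated_convergence)
    \<comment> \<open>Every partial sum of the exponential series is at most
      \<open>exp (norm z * norm w)\<close> in modulus, so one majorant serves all
      \<open>N\<close>.\<close>
    have "integrable lborel (\<lambda>w. (p w * of_real (exp (norm z * norm w))) * ?\<gamma> w)"
    proof (rule integrable_gauss_growth)
      show "(\<lambda>w. p w * of_real (exp (norm z * norm w))) \<in> borel_measurable borel"
        by (intro borel_measurable_continuous_onI continuous_intros cont)
      show "cmod (p w * of_real (exp (norm z * norm w))) \<le> C * exp ((1 + norm z) * norm w)" for w
        using mult_right_mono[OF bound[of w], of "exp (norm z * norm w)"]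
        by (simp add: norm_mult exp_add algebra_simps)
    qed
    then show "integrable lborel (\<lambda>w. norm ((p w * of_real (exp (norm z * norm w))) * ?\<gamma> w))"
      by (rule integrable_norm)
    show "AE w in lborel. norm (s N w) \<le> norm ((p w * of_real (exp (norm z * norm w))) * ?\<gamma> w)" for N
    proof (rule AE_I2)
      fix w
      have "cmod (\<Sum>j<N. herm z w ^ j / fact j) \<le> exp (norm z * norm w)"
        using norm_sum_exp_le[where x = "herm z w" and N = N] cmod_herm_le[of z w]
        by (meson exp_le_cancel_iff order_trans)
      then show "norm (s N w) \<le> norm ((p w * of_real (exp (norm z * norm w))) * ?\<gamma> w)"
        unfolding s_def norm_mult by (intro mult_right_mono mult_left_mono) auto
    qed
    show "AE w in lborel. (\<lambda>N. s N w) \<longlonglongrightarrow> p w * exp (herm z w) * ?\<gamma> w"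
    proof (rule AE_I2)
      fix w
      have "(\<lambda>j. herm z w ^ j / fact j) sums exp (herm z w)"
        using exp_converges[of "herm z w"] by (simp add: scaleR_conv_of_real divide_inverse mult.commute)
      then show "(\<lambda>N. s N w) \<longlonglongrightarrow> p w * exp (herm z w) * ?\<gamma> w"
        unfolding s_def sums_def by (intro tendsto_intros)
    qed
    have meas: "f \<in> borel_measurable lborel" if "continuous_on UNIV f" for f :: "complex ^ 'n \<Rightarrow> complex"
      using borel_measurable_continuous_onI[OF that] by simp
    show "s N \<in> borel_measurable lborel" for N
      unfolding s_def by (intro meas continuous_intros cont) simp
    show "(\<lambda>w. p w * exp (herm z w) * ?\<gamma> w) \<in> borel_measurable lborel"
      by (intro meas continuous_intros cont)
  qed
  \<comment> \<open>Once the degree \<open>?k\<close> is included, further terms integrate to 0, so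
    the sequence of integrals is eventually constant.\<close>
  moreover have "(\<integral>w. s N w \<partial>lborel) = ?M ?k / fact ?k" if "?k < N" for N
  proof -
    have "(\<integral>w. s N w \<partial>lborel) = (\<integral>w. (\<Sum>j<N. p w * herm z w ^ j * ?\<gamma> w / fact j) \<partial>lborel)"
      by (simp add: s_def sum_distrib_left sum_distrib_right)
    also have "\<dots> = (\<Sum>j<N. ?M j / fact j)"
      using term_int by (subst Bochner_Integration.integral_sum) auto
    also have "\<dots> = (\<Sum>j\<in>{?k}. ?M j / fact j)"
      using that by (intro sum.mono_neutral_right) (auto simp: zero)
    finally show ?thesis
      by simp
  qed
  then have "\<forall>\<^sub>F N in sequentially. (\<integral>w. s N w \<partial>lborel) = ?M ?k / fact ?k"
    using eventually_gt_at_top[of ?k] by (rule eventually_mono[rotated])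
  then have "(\<lambda>N. \<integral>w. s N w \<partial>lborel) \<longlonglongrightarrow> ?M ?k / fact ?k"
    by (rule tendsto_eventually)
  ultimately have "?M ?k / fact ?k = p z * ?G"
    unfolding total by (rule LIMSEQ_unique[symmetric])
  then show ?thesis
    by (simp add: field_simps)
qed

section \<open>The reproducing property on the ball\<close>

lemma set_integrable_ball_continuous:
  fixes f :: "'a::euclidean_space \<Rightarrow> 'b::{banach, second_countable_topology}"
  assumes "continuous_on (cball 0 1) f"
  shows "set_integrable lborel (ball 0 1) f"
proof -
  have "set_integrable lborel (cball 0 1) f"
    unfolding set_integrable_def using assms by (intro borel_integrable_compact) auto
  then show ?thesis
    by (rule set_integrable_subset) auto
qed

text \<open>For \<open>j = m + i\<close> the integrand is homogeneous of real degree
  \<open>2 * j\<close>, so its integral over the ball is the Gaussian moment divided by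
  \<open>fact (CARD('n) + j)\<close>; the remaining factorials form the reciprocal of a binomial
  coefficient. For other \<open>j\<close> a rotation kills the integral.\<close>

lemma ball_moment:
  fixes z u a :: "complex ^ 'n" and m i :: nat
  defines "p \<equiv> \<lambda>w. herm w u ^ m * herm w a ^ i"
  shows "(LINT w:unit_ball|lborel. p w * herm z w ^ j)
    = (if j = m + i then p z * of_real (measure lborel (unit_ball :: (complex ^ 'n) set))
         / of_nat ((CARD('n) + j) choose j) else 0)"
proof (cases "j = m + i")
  case True
  let ?n = "CARD('n)" and ?I = "LINT w:unit_ball|lborel. p w * herm z w ^ j"
    and ?v = "measure lborel (unit_ball :: (complex ^ 'n) set)"
  have cont: "continuous_on A (\<lambda>w. p w * herm z w ^ j)" for A
    unfolding p_def by (intro continuous_intros)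
  have "(\<integral>w. (p w * herm z w ^ j) * of_real (exp (- (norm w)\<^sup>2)) \<partial>lborel) = of_real (fact (?n + j)) * ?I"
  proof (rule integral_gauss_homogeneous)
    show "p (t *\<^sub>R w) * herm z (t *\<^sub>R w) ^ j = of_real (t ^ (2 * j)) * (p w * herm z w ^ j)" for t w
    proof -
      have "t *\<^sub>R w = of_real t *s w"
        by (simp add: vec_eq_iff scaleR_conv_of_real[where ?'a = complex])
      then show ?thesis
        by (simp add: p_def True herm_scale_left herm_scale_right power_mult_distrib power_add mult_2)
    qed
  qed (use cont in \<open>auto intro: borel_measurable_continuous_onI set_integrable_ball_continuous\<close>)
  then have "fact (?n + j) * ?I = fact j * p z * (fact ?n * of_real ?v)"
    using gauss_moment[of u m a i z, unfolded integral_gauss] by (simp add: p_def True)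
  moreover have "fact (?n + j) = (fact j * fact ?n * of_nat ((?n + j) choose j) :: complex)"
    using binomial_fact_lemma[of j "?n + j"]
    by (metis add_diff_cancel_right' le_add2 of_nat_fact of_nat_mult)
  ultimately have "of_nat ((?n + j) choose j) * ?I = p z * of_real ?v"
    by (simp add: mult_ac)
  then show ?thesis
    using True by (simp add: field_simps)
next
  case False
  have "(\<integral>w. indicator unit_ball w *\<^sub>R (p w * herm z w ^ j) \<partial>lborel) = 0"
  proof (rule integral_rotation_eq_0[OF _ _ False])
    have "(\<lambda>w. p w * herm z w ^ j) \<in> borel_measurable borel"
      unfolding p_def by (intro borel_measurable_continuous_onI continuous_intros)
    then show "(\<lambda>w. indicator unit_ball w *\<^sub>R (p w * herm z w ^ j)) \<in> borel_measurable borel"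
      by (intro borel_measurable_scaleR borel_measurable_indicator borel_open open_ball)
    show "indicator unit_ball (c *s w) *\<^sub>R (p (c *s w) * herm z (c *s w) ^ j)
        = c ^ (m + i) * cnj c ^ j * (indicator unit_ball w *\<^sub>R (p w * herm z w ^ j))"
      if "cmod c = 1" for c and w :: "complex ^ 'n"
      using that by (simp add: p_def herm_scale_left herm_scale_right norm_scale_vec
          power_mult_distrib power_add indicator_def)
  qed
  then show ?thesis
    using False by (simp add: set_lebesgue_integral_def)
qed

section \<open>Series expansion of the kernel and passage to linear fractional functions\<close>

text \<open>Induction on \<open>n\<close>: the Cauchy product with the geometric series raises the
  exponent by one, and the hockey-stick identity sums the coefficients. Absolute convergence is part
  of the induction because Cauchy products rely on it.\<close>

lemma negative_binomial_sums:
  fixes x :: "'a::{real_normed_field, banach}"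
  assumes x: "norm x < 1"
  shows "(\<lambda>j. of_nat ((n + j) choose j) * x ^ j) sums (1 / (1 - x) ^ (n + 1))"
    and "summable (\<lambda>j. norm (of_nat ((n + j) choose j) * x ^ j))"
proof -
  have "(\<lambda>j. of_nat ((n + j) choose j) * x ^ j) sums (1 / (1 - x) ^ (n + 1))
    \<and> summable (\<lambda>j. norm (of_nat ((n + j) choose j) * x ^ j))"
  proof (induction n)
    case 0
    then show ?case
      using geometric_sums[OF x] x by (simp add: norm_power)
  next
    case (Suc n)
    let ?a = "\<lambda>j. of_nat ((n + j) choose j) * x ^ j"
    have geom: "summable (\<lambda>j. norm (x ^ j))"
      using x by (simp add: norm_power)
    have choose: "(\<Sum>i\<le>k. of_nat ((n + i) choose i)) = (of_nat ((Suc n + k) choose k) :: 'a)"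
      "(\<Sum>i\<le>k. of_nat ((n + i) choose i)) = real ((Suc n + k) choose k)" for k
      by (simp_all add: sum_choose_lower flip: of_nat_sum)
    have conv: "(\<Sum>i\<le>k. ?a i * x ^ (k - i)) = of_nat ((Suc n + k) choose k) * x ^ k" for k
    proof -
      have "(\<Sum>i\<le>k. ?a i * x ^ (k - i)) = (\<Sum>i\<le>k. of_nat ((n + i) choose i) * x ^ k)"
        by (intro sum.cong) (auto simp: mult.assoc simp flip: power_add)
      then show ?thesis
        by (simp only: sum_distrib_right[symmetric] choose)
    qed
    have convn: "(\<Sum>i\<le>k. norm (?a i) * norm (x ^ (k - i))) = norm (of_nat ((Suc n + k) choose k) * x ^ k)" for k
    proof -
      have "(\<Sum>i\<le>k. norm (?a i) * norm (x ^ (k - i))) = (\<Sum>i\<le>k. of_nat ((n + i) choose i) * norm x ^ k)"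
        by (intro sum.cong) (auto simp: norm_mult norm_power mult.assoc simp flip: power_add)
      then show ?thesis
        by (simp only: sum_distrib_right[symmetric] choose norm_mult norm_power norm_of_nat)
    qed
    have "(\<lambda>k. \<Sum>i\<le>k. ?a i * x ^ (k - i)) sums (suminf ?a * (\<Sum>j. x ^ j))"
      using Suc geom by (intro Cauchy_product_sums) auto
    moreover have "suminf ?a * (\<Sum>j. x ^ j) = 1 / (1 - x) ^ (Suc n + 1)"
      using sums_unique[OF conjunct1[OF Suc], symmetric] suminf_geometric[OF x] by simp
    moreover have "(\<lambda>k. \<Sum>i\<le>k. norm (?a i) * norm (x ^ (k - i))) sums
        ((\<Sum>j. norm (?a j)) * (\<Sum>j. norm (x ^ j)))"
      using Suc geom by (intro Cauchy_product_sums) auto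
    ultimately show ?case
      unfolding conv convn by (auto simp: sums_iff)
  qed
  then show "(\<lambda>j. of_nat ((n + j) choose j) * x ^ j) sums (1 / (1 - x) ^ (n + 1))"
    and "summable (\<lambda>j. norm (of_nat ((n + j) choose j) * x ^ j))"
    by blast+
qed

text \<open>Bounded convergence: the ball has finite volume, so a constant is an integrable
  majorant. Continuity up to the boundary supplies measurability.\<close>

lemma ball_integral_lim:
  fixes f :: "'a::euclidean_space \<Rightarrow> complex"
  assumes s: "\<And>N. continuous_on (cball 0 1) (s N)" and f: "continuous_on (cball 0 1) f"
    and lim: "\<And>w. w \<in> ball 0 1 \<Longrightarrow> (\<lambda>N. s N w) \<longlonglongrightarrow> f w"
    and bound: "\<And>N w. w \<in> ball 0 1 \<Longrightarrow> cmod (s N w) \<le> C"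
  shows "(\<lambda>N. LINT w:ball 0 1|lborel. s N w) \<longlonglongrightarrow> (LINT w:ball 0 1|lborel. f w)"
  unfolding set_lebesgue_integral_def
proof (rule integral_dominated_convergence)
  have "set_integrable lborel (ball (0::'a) 1) (\<lambda>_. C)"
    by (intro set_integrable_ball_continuous continuous_intros)
  then show "integrable lborel (\<lambda>w :: 'a. indicator (ball 0 1) w *\<^sub>R C)"
    by (simp add: set_integrable_def)
  show "(\<lambda>w. indicator (ball 0 1) w *\<^sub>R s N w) \<in> borel_measurable lborel" for N
    using set_integrable_ball_continuous[OF s] unfolding set_integrable_def
    by (rule borel_measurable_integrable)
  show "(\<lambda>w. indicator (ball 0 1) w *\<^sub>R f w) \<in> borel_measurable lborel"
    using set_integrable_ball_continuous[OF f] unfolding set_integrable_def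
    by (rule borel_measurable_integrable)
  show "AE w in lborel. (\<lambda>N. indicator (ball 0 1) w *\<^sub>R s N w) \<longlonglongrightarrow> indicator (ball 0 1) w *\<^sub>R f w"
    by (rule AE_I2) (auto simp: indicator_def lim)
  show "AE w in lborel. norm (indicator (ball 0 1) w *\<^sub>R s N w) \<le> indicator (ball 0 1) w *\<^sub>R C" for N
    by (rule AE_I2) (auto simp: indicator_def bound)
qed

lemma cmod_herm_less_1:
  assumes "norm x < 1" "norm y \<le> 1"
  shows "cmod (herm x y) < 1"
  using cmod_herm_le[of x y] mult_left_mono[OF assms(2) norm_ge_zero[of x]] assms(1) by linarith

lemma one_minus_herm_nonzero:
  assumes "norm x < 1" "norm y \<le> 1"
  shows "1 - herm x y \<noteq> 0" "1 - herm y x \<noteq> 0"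
  using cmod_herm_less_1[OF assms] cnj_herm[of x y] by (auto simp del: complex_mod_cnj)

text \<open>The coefficients are nonnegative, so the full series at \<open>r\<close> dominates. The
  bound is independent of \<open>N\<close>, as dominated convergence demands.\<close>

lemma norm_negative_binomial_partial_le:
  fixes x :: complex
  assumes "cmod x \<le> r" "r < 1"
  shows "cmod (\<Sum>j<N. of_nat ((n + j) choose j) * x ^ j) \<le> 1 / (1 - r) ^ (n + 1)"
proof -
  have "0 \<le> r"
    using assms(1) norm_ge_zero order_trans by blast
  have "cmod (\<Sum>j<N. of_nat ((n + j) choose j) * x ^ j) \<le> (\<Sum>j<N. real ((n + j) choose j) * r ^ j)"
    using assms(1) by (intro sum_norm_le) (auto simp: norm_mult norm_power intro!: mult_left_mono power_mono)
  also have "\<dots> \<le> 1 / (1 - r) ^ (n + 1)"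
    using negative_binomial_sums(1)[of r n] assms(2) \<open>0 \<le> r\<close>
      sum_le_suminf[of "\<lambda>j. real ((n + j) choose j) * r ^ j" "{..<N}"]
    by (auto simp: sums_iff)
  finally show ?thesis .
qed

text \<open>The binomial coefficients in the expansion of the kernel are exactly the reciprocals of
  those in \<open>ball_moment\<close>. Only the term \<open>j = m + i\<close> contributes, and there
  the two cancel.\<close>

lemma reproducing_monomial:
  fixes z u a :: "complex ^ 'n" and m i :: nat
  assumes z: "norm z < 1"
  defines "p \<equiv> \<lambda>w. herm w u ^ m * herm w a ^ i"
  shows "(LINT w:unit_ball|lborel. p w * (1 / (1 - herm z w) ^ (CARD('n) + 1)))
    = of_real (measure lborel (unit_ball :: (complex ^ 'n) set)) * p z"
proof -
  let ?n = "CARD('n)" and ?v = "measure lborel (unit_ball :: (complex ^ 'n) set)"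
  define s where "s N w = p w * (\<Sum>j<N. of_nat ((?n + j) choose j) * herm z w ^ j)" for N w
  have "(\<lambda>N. LINT w:unit_ball|lborel. s N w) \<longlonglongrightarrow>
      (LINT w:unit_ball|lborel. p w * (1 / (1 - herm z w) ^ (?n + 1)))"
  proof (rule ball_integral_lim)
    show "continuous_on (cball 0 1) (s N)" for N
      unfolding s_def p_def by (intro continuous_intros)
    show "continuous_on (cball 0 1) (\<lambda>w. p w * (1 / (1 - herm z w) ^ (?n + 1)))"
      unfolding p_def using one_minus_herm_nonzero(1)[OF z]
      by (intro continuous_intros) auto
    show "(\<lambda>N. s N w) \<longlonglongrightarrow> p w * (1 / (1 - herm z w) ^ (?n + 1))" if "w \<in> unit_ball" for w
      using negative_binomial_sums(1)[OF cmod_herm_less_1[OF z, of w], of ?n] that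
      unfolding s_def sums_def by (intro tendsto_mult_left) auto
    show "cmod (s N w) \<le> (norm u ^ m * norm a ^ i) * (1 / (1 - norm z) ^ (?n + 1))"
      if "w \<in> unit_ball" for N w
      unfolding s_def norm_mult
    proof (intro mult_mono norm_negative_binomial_partial_le)
      have w: "norm w \<le> 1"
        using that by simp
      show "cmod (p w) \<le> norm u ^ m * norm a ^ i"
        using norm_herm_monomial_le[of w u m a i] power_le_one[OF norm_ge_zero w, of "m + i"]
        unfolding p_def by (rule order_trans[OF _ mult_left_le]) auto
      show "cmod (herm z w) \<le> norm z"
        using cmod_herm_le[of z w] mult_left_le[OF w norm_ge_zero[of z]] by linarith
    qed (use z in auto)
  qed
  moreover have "(LINT w:unit_ball|lborel. s N w) = of_real ?v * p z" if "m + i < N" for N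
  proof -
    have int: "set_integrable lborel unit_ball (\<lambda>w. p w * herm z w ^ j)" for j
      unfolding p_def by (intro set_integrable_ball_continuous continuous_intros)
    have "(LINT w:unit_ball|lborel. s N w)
        = (\<integral>w. (\<Sum>j<N. of_nat ((?n + j) choose j) * (indicator unit_ball w *\<^sub>R (p w * herm z w ^ j))) \<partial>lborel)"
      unfolding set_lebesgue_integral_def s_def
      by (simp add: sum_distrib_left scaleR_sum_right mult_ac)
    also have "\<dots> = (\<Sum>j<N. of_nat ((?n + j) choose j) * (LINT w:unit_ball|lborel. p w * herm z w ^ j))"
      using int by (simp only: Bochner_Integration.integral_sum integrable_mult_right
          integral_mult_right_zero set_lebesgue_integral_def set_integrable_def)
    also have "\<dots> = (\<Sum>j\<in>{m + i}. of_nat ((?n + j) choose j) * (LINT w:unit_ball|lborel. p w * herm z w ^ j))"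
      using that unfolding p_def ball_moment by (intro sum.mono_neutral_right) auto
    also have "\<dots> = of_real ?v * p z"
      by (simp add: p_def ball_moment)
    finally show ?thesis .
  qed
  then have "\<forall>\<^sub>F N in sequentially. (LINT w:unit_ball|lborel. s N w) = of_real ?v * p z"
    using eventually_gt_at_top[of "m + i"] by (rule eventually_mono[rotated])
  then have "(\<lambda>N. LINT w:unit_ball|lborel. s N w) \<longlonglongrightarrow> of_real ?v * p z"
    by (rule tendsto_eventually)
  ultimately show ?thesis
    by (rule LIMSEQ_unique)
qed

text \<open>The denominator is expanded into a series and the numerator by the binomial theorem, so
  the truncations are finite combinations of the monomials above. Since \<open>norm u < 1\<close>,
  they stay bounded and converge on the closed ball. This family contains the kernel, up to a
  constant (\<open>a = 0\<close>, \<open>u = z\<close>), and its composition with the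
  automorphism.\<close>

lemma reproducing_fractional:
  fixes z u a :: "complex ^ 'n"
  assumes z: "norm z < 1" and u: "norm u < 1"
  defines "f \<equiv> \<lambda>w. ((1 - herm w a) / (1 - herm w u)) ^ (CARD('n) + 1)"
  shows "(LINT w:unit_ball|lborel. f w * (1 / (1 - herm z w) ^ (CARD('n) + 1)))
    = of_real (measure lborel (unit_ball :: (complex ^ 'n) set)) * f z"
proof -
  let ?n = "CARD('n)" and ?v = "measure lborel (unit_ball :: (complex ^ 'n) set)"
  let ?K = "\<lambda>w. 1 / (1 - herm z w) ^ (?n + 1)"
  define s where "s N w = (\<Sum>j<N. of_nat ((?n + j) choose j) * herm w u ^ j) * (1 - herm w a) ^ (?n + 1)"
    for N w
  have f_alt: "f w = 1 / (1 - herm w u) ^ (?n + 1) * (1 - herm w a) ^ (?n + 1)" for w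
    by (simp add: f_def power_divide)
  have K_cont: "continuous_on (cball 0 1) ?K"
    using one_minus_herm_nonzero(1)[OF z] by (intro continuous_intros) auto
  have s_lim: "(\<lambda>N. s N w) \<longlonglongrightarrow> f w" if "norm w \<le> 1" for w
  proof -
    have "cmod (herm w u) < 1"
      using cmod_herm_less_1[OF u that] cnj_herm[of u w] complex_mod_cnj by metis
    from negative_binomial_sums(1)[OF this, of ?n] show ?thesis
      unfolding s_def f_alt sums_def by (rule tendsto_mult_right)
  qed
  \<comment> \<open>The remaining kernel factor is bounded because it is continuous on the compact
    closed ball.\<close>
  obtain B where "\<forall>x\<in>?K ` cball 0 1. cmod x \<le> B"
    using compact_imp_bounded[OF compact_continuous_image[OF K_cont compact_cball]]
    by (auto simp only: bounded_iff)
  then have B: "cmod (?K w) \<le> B" if "norm w \<le> 1" for w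
    using that by (simp only: ball_simps mem_cball_0)
  have "(\<lambda>N. LINT w:unit_ball|lborel. s N w * ?K w) \<longlonglongrightarrow> (LINT w:unit_ball|lborel. f w * ?K w)"
  proof (rule ball_integral_lim)
    show "continuous_on (cball 0 1) (\<lambda>w. s N w * ?K w)" for N
      unfolding s_def by (intro continuous_intros K_cont)
    show "continuous_on (cball 0 1) (\<lambda>w. f w * ?K w)"
      unfolding f_def using one_minus_herm_nonzero(2)[OF u]
      by (intro continuous_on_mult K_cont continuous_intros) auto
    show "(\<lambda>N. s N w * ?K w) \<longlonglongrightarrow> f w * ?K w" if "w \<in> unit_ball" for w
      using that by (intro tendsto_mult_right s_lim) simp
    show "cmod (s N w * ?K w) \<le> (1 / (1 - norm u) ^ (?n + 1) * (1 + norm a) ^ (?n + 1)) * B"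
      if "w \<in> unit_ball" for N w
    proof -
      have w: "norm w \<le> 1"
        using that by simp
      have "cmod (herm w u) \<le> norm u" "cmod (herm w a) \<le> norm a"
        using cmod_herm_le[of w] mult_right_mono[OF w norm_ge_zero] by (metis mult_1 order_trans)+
      then have "cmod (1 - herm w a) \<le> 1 + norm a"
        using norm_triangle_ineq4[of 1 "herm w a"] by simp
      have "cmod (\<Sum>j<N. of_nat ((?n + j) choose j) * herm w u ^ j) \<le> 1 / (1 - norm u) ^ (?n + 1)"
        by (rule norm_negative_binomial_partial_le) fact+
      moreover have "cmod ((1 - herm w a) ^ (?n + 1)) \<le> (1 + norm a) ^ (?n + 1)"
        unfolding norm_power by (rule power_mono) (fact, simp)
      moreover have "0 \<le> 1 / (1 - norm u) ^ (?n + 1)"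
        using u by simp
      ultimately show ?thesis
        unfolding norm_mult s_def by (intro mult_mono B[OF w] mult_nonneg_nonneg) auto
    qed
  qed
  moreover have "(LINT w:unit_ball|lborel. s N w * ?K w) = of_real ?v * s N z" for N
  proof -
    define c where "c j i = complex_of_nat ((?n + j) choose j) * (of_nat ((?n + 1) choose i) * (- 1) ^ i)"
      for j i :: nat
    define p where "p j i w = herm w u ^ j * herm w a ^ i" for j i w
    have expand: "s N w = (\<Sum>j<N. \<Sum>i\<le>?n + 1. c j i * p j i w)" for w
    proof -
      have "(1 - herm w a) ^ (?n + 1) = (- herm w a + 1) ^ (?n + 1)"
        by simp
      also have "\<dots> = (\<Sum>i\<le>?n + 1. of_nat ((?n + 1) choose i) * (- 1) ^ i * herm w a ^ i)"
        unfolding binomial_ring by (simp add: power_minus[of "herm w a"] mult_ac)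
      finally show ?thesis
        unfolding s_def c_def p_def by (simp only: sum_product) (simp only: mult_ac)
    qed
    have "set_integrable lborel unit_ball (\<lambda>w. p j i w * ?K w)" for j i
      unfolding p_def by (intro set_integrable_ball_continuous continuous_intros K_cont)
    then have int: "integrable lborel (\<lambda>w. c j i * (indicator unit_ball w *\<^sub>R (p j i w * ?K w)))" for j i
      unfolding set_integrable_def by (intro integrable_mult_right)
    have "(LINT w:unit_ball|lborel. s N w * ?K w)
        = (\<integral>w. (\<Sum>j<N. \<Sum>i\<le>?n + 1. c j i * (indicator unit_ball w *\<^sub>R (p j i w * ?K w))) \<partial>lborel)"
      unfolding set_lebesgue_integral_def expand
      by (intro Bochner_Integration.integral_cong refl)
        (simp only: sum_distrib_right scaleR_sum_right mult_scaleR_right mult.assoc)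
    also have "\<dots> = (\<Sum>j<N. \<Sum>i\<le>?n + 1. c j i * (LINT w:unit_ball|lborel. p j i w * ?K w))"
      using int by (simp only: Bochner_Integration.integral_sum Bochner_Integration.integrable_sum
          integral_mult_right_zero set_lebesgue_integral_def)
    also have "\<dots> = of_real ?v * s N z"
      unfolding p_def reproducing_monomial[OF z] unfolding expand p_def
      by (simp only: sum_distrib_left mult.left_commute)
    finally show ?thesis .
  qed
  moreover have "(\<lambda>N. of_real ?v * s N z) \<longlonglongrightarrow> of_real ?v * f z"
    using z by (intro tendsto_mult_left s_lim) simp
  ultimately show ?thesis
    by (simp add: LIMSEQ_unique)
qed

section \<open>The Berezin transform\<close>

lemma ball_volume_pos: "0 < measure lborel (unit_ball :: (complex ^ 'n) set)"
  by simp

lemma bergman_inner_kernel: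
  "bergman_inner f (bergman_kernel z)
    = of_real (fact CARD('n) / pi ^ CARD('n)) *
      (LINT w:unit_ball|lborel. f w * (1 / (1 - herm z w) ^ (CARD('n) + 1)))"
  for z :: "complex ^ 'n"
  unfolding bergman_inner_def set_integral_mult_right[symmetric]
  by (rule set_lebesgue_integral_cong)
    (auto simp: bergman_kernel_def cnj_herm mult_ac)

lemma bergman_kernel_self:
  "bergman_kernel z z = of_real (fact CARD('n) / (pi ^ CARD('n) * (1 - (norm z)\<^sup>2) ^ (CARD('n) + 1)))"
  for z :: "complex ^ 'n"
  by (simp add: bergman_kernel_def herm_self)

text \<open>The kernel is a constant times a linear fractional power with numerator vector 0 and
  denominator vector \<open>z\<close>. The factor containing the ball volume reappears for the
  composed kernel and cancels there.\<close>

lemma bergman_inner_kernel_kernel: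
  fixes z :: "complex ^ 'n"
  assumes z: "norm z < 1"
  shows "bergman_inner (bergman_kernel z) (bergman_kernel z)
    = of_real (fact CARD('n) / pi ^ CARD('n) * measure lborel (unit_ball :: (complex ^ 'n) set))
      * bergman_kernel z z"
proof -
  let ?\<kappa> = "complex_of_real (fact CARD('n) / pi ^ CARD('n))"
  have eq: "bergman_kernel z w = ?\<kappa> * ((1 - herm w 0) / (1 - herm w z)) ^ (CARD('n) + 1)" for w
    by (simp add: bergman_kernel_def power_divide)
  have "bergman_inner (bergman_kernel z) (bergman_kernel z) = ?\<kappa> * (?\<kappa> *
      (LINT w:unit_ball|lborel. ((1 - herm w 0) / (1 - herm w z)) ^ (CARD('n) + 1)
        * (1 / (1 - herm z w) ^ (CARD('n) + 1))))"
    unfolding bergman_inner_kernel unfolding eq mult.assoc[of ?\<kappa>] set_integral_mult_right ..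
  then show ?thesis
    unfolding reproducing_fractional[OF z z] eq[of z] by (simp only: of_real_mult mult_ac)
qed

lemma bergman_norm_kernel:
  fixes z :: "complex ^ 'n"
  assumes z: "norm z < 1"
  shows "of_real ((bergman_norm (bergman_kernel z))\<^sup>2)
      = of_real (fact CARD('n) / pi ^ CARD('n) * measure lborel (unit_ball :: (complex ^ 'n) set))
        * bergman_kernel z z"
    and "0 < bergman_norm (bergman_kernel z)"
proof -
  define r where "r = fact CARD('n) / pi ^ CARD('n) * measure lborel (unit_ball :: (complex ^ 'n) set)
    * (fact CARD('n) / (pi ^ CARD('n) * (1 - (norm z)\<^sup>2) ^ (CARD('n) + 1)))"
  have "(norm z)\<^sup>2 < 1"
    using z by (metis abs_norm_cancel abs_square_less_1)
  then have pos: "0 < r"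
    using ball_volume_pos unfolding r_def by (intro mult_pos_pos divide_pos_pos) auto
  have eq: "bergman_inner (bergman_kernel z) (bergman_kernel z) = of_real r"
    unfolding bergman_inner_kernel_kernel[OF z] bergman_kernel_self r_def by simp
  show "0 < bergman_norm (bergman_kernel z)"
    unfolding bergman_norm_def eq using pos by simp
  show "of_real ((bergman_norm (bergman_kernel z))\<^sup>2)
      = of_real (fact CARD('n) / pi ^ CARD('n) * measure lborel (unit_ball :: (complex ^ 'n) set))
        * bergman_kernel z z"
    unfolding bergman_inner_kernel_kernel[OF z, symmetric] eq bergman_norm_def
    using pos by simp
qed

text \<open>\<open>composition_operator\<close> is a restricted function, \<open>undefined\<close>
  off the Bergman space, so membership is what allows it to be evaluated at the normalized
  kernel.\<close>

lemma normalized_kernel_in_bergman_space: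
  fixes z :: "complex ^ 'n"
  assumes z: "norm z < 1"
  shows "normalized_kernel z \<in> bergman_space"
proof -
  define c :: complex where "c = of_real (fact CARD('n)) / of_real (pi ^ CARD('n)) / of_real (bergman_norm (bergman_kernel z))"
  have eq: "normalized_kernel z = (\<lambda>w. c / (1 - herm w z) ^ (CARD('n) + 1))"
    by (simp add: fun_eq_iff normalized_kernel_def bergman_kernel_def c_def)
  have "\<exists>D. ((\<lambda>w. c / (1 - herm w z) ^ (CARD('n) + 1)) has_derivative D) (at w within unit_ball)
      \<and> (\<forall>a v. D (a *s v) = a * D v)" if "w \<in> unit_ball" for w
  proof -
    have "1 - herm w z \<noteq> 0"
      using one_minus_herm_nonzero(2)[OF z, of w] that by simp
    then have "(\<lambda>x. c / (1 - x) ^ (CARD('n) + 1)) field_differentiable at (herm w z)"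
      by (intro derivative_intros) auto
    then obtain d where d: "((\<lambda>x. c / (1 - x) ^ (CARD('n) + 1)) has_field_derivative d) (at (herm w z))"
      unfolding field_differentiable_def ..
    have "((\<lambda>w. c / (1 - herm w z) ^ (CARD('n) + 1)) has_derivative (\<lambda>v. d * herm v z)) (at w within unit_ball)"
      using has_derivative_compose[OF bounded_linear.has_derivative[OF bounded_linear_herm has_derivative_ident]
          d[unfolded has_field_derivative_def]] .
    then show ?thesis
      by (auto simp: herm_scale_left)
  qed
  moreover have "set_integrable lborel unit_ball (\<lambda>w. (norm (c / (1 - herm w z) ^ (CARD('n) + 1)))\<^sup>2)"
    using one_minus_herm_nonzero(2)[OF z]
    by (intro set_integrable_ball_continuous continuous_intros) auto
  ultimately show ?thesis
    by (simp add: bergman_space_def holomorphic_several_on_def eq)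
qed

section \<open>The kernel composed with the ball automorphism\<close>

lemma herm_proj_along_sym: "herm (proj_along a w) z = herm w (proj_along a z)"
  by (simp add: proj_along_def herm_scale_left herm_scale_right cnj_herm)

text \<open>Both projections are self-adjoint, so they can be moved onto \<open>z\<close>. This
  exhibits the expression as a linear fractional function of \<open>w\<close>, the shape required by
  \<open>reproducing_fractional\<close>.\<close>

lemma one_minus_herm_ball_aut_neg:
  fixes a w z :: "complex ^ 'n"
  assumes "1 - herm w a \<noteq> 0"
  defines "s \<equiv> complex_of_real (sqrt (1 - (norm a)\<^sup>2))"
  shows "1 - herm (ball_aut_neg a w) z
    = (1 + herm a z - herm w (a + proj_along a z + s *s proj_perp a z)) / (1 - herm w a)"
proof -
  have "herm (proj_perp a w) z = herm w (proj_perp a z)"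
    by (simp add: proj_perp_def herm_diff_left herm_diff_right herm_proj_along_sym)
  moreover have "cnj s = s"
    by (simp add: s_def)
  ultimately have "herm (ball_aut_neg a w) z = - (1 / (1 - herm w a) *
      (herm a z - herm w (proj_along a z) - s * herm w (proj_perp a z)))"
    unfolding ball_aut_neg_def s_def[symmetric] herm_minus_left herm_scale_left herm_diff_left
    by (simp add: herm_proj_along_sym)
  then show ?thesis
    using assms(1) \<open>cnj s = s\<close> by (simp add: herm_add_right herm_scale_right field_simps)
qed

text \<open>This is the standard identity for \<open>1 - |\<phi>|^2\<close>, for the involution
  exchanging 0 and \<open>a\<close>, taken at \<open>- z\<close> and cleared of denominators. Its
  positive right side keeps the zero set of the new denominator away from the closed ball.\<close>

lemma norm_ball_aut_denominator:
  fixes a z :: "complex ^ 'n"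
  assumes a: "norm a < 1"
  defines "s \<equiv> complex_of_real (sqrt (1 - (norm a)\<^sup>2))"
  shows "(cmod (1 + herm a z))\<^sup>2 - (norm (a + proj_along a z + s *s proj_perp a z))\<^sup>2
    = (1 - (norm a)\<^sup>2) * (1 - (norm z)\<^sup>2)"
proof (cases "a = 0")
  case True
  then show ?thesis
    by (simp add: s_def proj_along_def proj_perp_def vector_smult_lid)
next
  case False
  define b where "b = a + proj_along a z + s *s proj_perp a z"
  define h where "h = herm z a"
  define r where "r = complex_of_real ((norm a)\<^sup>2)"
  have "r \<noteq> 0"
    using False by (simp add: r_def)
  have "(norm a)\<^sup>2 < 1"
    using a by (metis abs_norm_cancel abs_square_less_1)
  then have s2: "s * s = 1 - r"
    by (simp add: s_def r_def flip: of_real_mult)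
  have cs: "cnj s = s" "cnj r = r"
    by (simp_all add: s_def r_def)
  \<comment> \<open>Collecting the multiples of \<open>a\<close> writes the vector as a combination
    of \<open>a\<close> and \<open>z\<close> alone, so that its norm needs only \<open>h\<close>,
    \<open>r\<close> and \<open>herm z z\<close>.\<close>
  define c where "c = 1 + (1 - s) * h / r"
  have b: "b = c *s a + s *s z"
    using False by (simp add: b_def c_def h_def r_def proj_along_def proj_perp_def vec_eq_iff algebra_simps
        diff_divide_distrib)
  have haz: "herm a z = cnj h" "herm z a = h" "herm a a = r"
    by (simp_all add: h_def cnj_herm r_def herm_self)
  have "herm b b = c * cnj c * r + c * s * cnj h + s * cnj c * h + s * s * herm z z"
    unfolding b by (simp add: herm_add_left herm_add_right herm_scale_left herm_scale_right haz cs algebra_simps)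
  also have "\<dots> = r + (h + cnj h) + h * cnj h / r * (1 - s * s) + s * s * herm z z"
    using \<open>r \<noteq> 0\<close> by (simp add: c_def cs field_simps)
  also have "\<dots> = r + (h + cnj h) + h * cnj h + (1 - r) * herm z z"
    using \<open>r \<noteq> 0\<close> by (simp add: s2)
  finally have hb: "herm b b = r + (h + cnj h) + h * cnj h + (1 - r) * herm z z" .
  have "complex_of_real ((cmod (1 + herm a z))\<^sup>2 - (norm b)\<^sup>2)
      = (1 + cnj h) * (1 + h) - herm b b"
    unfolding of_real_diff herm_self complex_norm_square haz by simp
  also have "\<dots> = complex_of_real ((1 - (norm a)\<^sup>2) * (1 - (norm z)\<^sup>2))"
    unfolding hb of_real_mult of_real_diff r_def[symmetric] herm_self[symmetric]
    by (simp add: haz algebra_simps)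
  finally show ?thesis
    unfolding b_def of_real_eq_iff .
qed

text \<open>The composed kernel is a constant times a power of
  \<open>(1 - herm w a) / (1 - herm w u)\<close> for some \<open>u\<close> in the ball, so it is
  reproduced at \<open>z\<close>. The second claim later excludes 0 from the range.\<close>

lemma bergman_inner_kernel_ball_aut_neg:
  fixes a z :: "complex ^ 'n"
  assumes a: "norm a < 1" and z: "norm z < 1"
  shows "bergman_inner (bergman_kernel z \<circ> ball_aut_neg a) (bergman_kernel z)
      = of_real (fact CARD('n) / pi ^ CARD('n) * measure lborel (unit_ball :: (complex ^ 'n) set))
        * bergman_kernel z (ball_aut_neg a z)"
    and "1 - herm (ball_aut_neg a z) z \<noteq> 0"
proof -
  let ?n = "CARD('n)"
  let ?\<kappa> = "complex_of_real (fact ?n / pi ^ ?n)"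
  define b where "b = a + proj_along a z + complex_of_real (sqrt (1 - (norm a)\<^sup>2)) *s proj_perp a z"
  define \<alpha> where "\<alpha> = 1 + herm a z"
  \<comment> \<open>The form is conjugate-linear on the right, so dividing by
    \<open>cnj \<alpha>\<close> here pulls the factor \<open>\<alpha>\<close> out of
    \<open>\<alpha> - herm w b\<close>.\<close>
  define u where "u = (1 / cnj \<alpha>) *s b"
  have "0 < (1 - (norm a)\<^sup>2) * (1 - (norm z)\<^sup>2)"
    using a z by (metis abs_norm_cancel abs_square_less_1 diff_gt_0_iff_gt mult_pos_pos)
  then have "(norm b)\<^sup>2 < (cmod \<alpha>)\<^sup>2"
    using norm_ball_aut_denominator[OF a, of z] unfolding b_def \<alpha>_def by linarith
  then have lt: "norm b < cmod \<alpha>"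
    by (rule power_less_imp_less_base) simp
  then have "\<alpha> \<noteq> 0"
    by auto
  have u: "norm u < 1"
    using lt \<open>\<alpha> \<noteq> 0\<close> by (simp add: u_def norm_scale_vec norm_divide)
  have den: "1 - herm (ball_aut_neg a w) z = \<alpha> * ((1 - herm w u) / (1 - herm w a))"
    if "norm w \<le> 1" for w
    using one_minus_herm_ball_aut_neg[OF one_minus_herm_nonzero(2)[OF a that], of z] \<open>\<alpha> \<noteq> 0\<close>
    by (simp add: b_def[symmetric] \<alpha>_def[symmetric] u_def herm_scale_right right_diff_distrib)
  have ker: "bergman_kernel z (ball_aut_neg a w)
      = ?\<kappa> / \<alpha> ^ (?n + 1) * ((1 - herm w a) / (1 - herm w u)) ^ (?n + 1)" if "norm w \<le> 1" for w
    unfolding bergman_kernel_def den[OF that] power_mult_distrib power_divide by simp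
  show "1 - herm (ball_aut_neg a z) z \<noteq> 0"
    using z \<open>\<alpha> \<noteq> 0\<close> one_minus_herm_nonzero(2)[OF u, of z] one_minus_herm_nonzero(2)[OF a, of z]
    by (simp add: den)
  have "bergman_inner (bergman_kernel z \<circ> ball_aut_neg a) (bergman_kernel z)
      = ?\<kappa> * (LINT w:unit_ball|lborel. ?\<kappa> / \<alpha> ^ (?n + 1) *
          (((1 - herm w a) / (1 - herm w u)) ^ (?n + 1) * (1 / (1 - herm z w) ^ (?n + 1))))"
    unfolding bergman_inner_kernel
    by (intro arg_cong2[where f = "(*)"] refl set_lebesgue_integral_cong)
      (auto simp: ker simp del: times_divide_eq_right times_divide_eq_left)
  also have "\<dots> = ?\<kappa> * (of_real (measure lborel (unit_ball :: (complex ^ 'n) set)) *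
      bergman_kernel z (ball_aut_neg a z))"
    unfolding set_integral_mult_right reproducing_fractional[OF z u] using z
    by (subst ker) (simp_all only: less_imp_le mult_ac)
  finally show "bergman_inner (bergman_kernel z \<circ> ball_aut_neg a) (bergman_kernel z)
      = of_real (fact CARD('n) / pi ^ CARD('n) * measure lborel (unit_ball :: (complex ^ 'n) set))
        * bergman_kernel z (ball_aut_neg a z)"
    by (simp only: of_real_mult mult.assoc)
qed

text \<open>The squared norm of the kernel shares the factor \<open>?v\<close> with the inner
  product; what remains is a quotient of two kernel values.\<close>

lemma berezin_transform_ball_aut_neg:
  fixes a z :: "complex ^ 'n"
  assumes a: "norm a < 1" and z: "norm z < 1"
  shows "berezin_transform (composition_operator (ball_aut_neg a)) z
    = (of_real (1 - (norm z)\<^sup>2) / (1 - herm (ball_aut_neg a z) z)) ^ (CARD('n) + 1)"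
proof -
  let ?N = "bergman_norm (bergman_kernel z)"
  let ?v = "complex_of_real (fact CARD('n) / pi ^ CARD('n) * measure lborel (unit_ball :: (complex ^ 'n) set))"
  have "?v \<noteq> 0"
    using ball_volume_pos[where ?'n = 'n] by simp
  have "berezin_transform (composition_operator (ball_aut_neg a)) z
      = bergman_inner (bergman_kernel z \<circ> ball_aut_neg a) (bergman_kernel z) / of_real (?N\<^sup>2)"
    unfolding berezin_transform_def composition_operator_def
      restrict_apply'[OF normalized_kernel_in_bergman_space[OF z]] bergman_inner_def
      set_integral_divide_zero[symmetric]
    by (rule set_lebesgue_integral_cong) (auto simp: normalized_kernel_def power2_eq_square)
  also have "\<dots> = bergman_kernel z (ball_aut_neg a z) / bergman_kernel z z"
    unfolding bergman_inner_kernel_ball_aut_neg(1)[OF a z] bergman_norm_kernel(1)[OF z]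
    using \<open>?v \<noteq> 0\<close> by simp
  also have "\<dots> = (of_real (1 - (norm z)\<^sup>2) / (1 - herm (ball_aut_neg a z) z)) ^ (CARD('n) + 1)"
    unfolding bergman_kernel_def herm_self by (simp add: power_divide)
  finally show ?thesis .
qed

section \<open>Values of the transform on the complex line through \<open>a\<close>\<close>

text \<open>At \<open>z = l a / |a|\<close> the perpendicular part vanishes and with it the square
  root. The denominator simplifies because \<open>cnj l - l\<close> is
  \<open>- 2 * \<i> * Im l\<close>.\<close>

lemma berezin_transform_slice:
  fixes a :: "complex ^ 'n"
  assumes a: "norm a < 1" "a \<noteq> 0" and l: "cmod l < 1"
  shows "berezin_transform (composition_operator (ball_aut_neg a)) ((l / of_real (norm a)) *s a)
    = (of_real (1 - (cmod l)\<^sup>2) * (1 - l * of_real (norm a))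
        / (of_real (1 - (cmod l)\<^sup>2) - 2 * \<i> * of_real (norm a * Im l))) ^ (CARD('n) + 1)"
proof -
  let ?r = "complex_of_real (norm a)"
  define z where "z = (l / ?r) *s a"
  have nz: "norm z = cmod l"
    using a by (simp add: z_def norm_scale_vec norm_divide)
  have za: "herm z a = l * ?r"
    using a by (simp add: z_def herm_scale_left herm_self power2_eq_square)
  then have az: "herm a z = cnj l * ?r"
    using cnj_herm[of z a] by simp
  have proj: "proj_along a z = z"
    using a za by (simp add: proj_along_def z_def power2_eq_square)
  have perp: "proj_perp a z = 0"
    by (simp add: proj_perp_def proj)
  have "1 - herm (ball_aut_neg a z) z = (1 + cnj l * ?r - (l * ?r + of_real ((cmod l)\<^sup>2))) / (1 - l * ?r)"
    using one_minus_herm_ball_aut_neg[of z a z] one_minus_herm_nonzero(2)[OF a(1), of z] l nz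
    by (simp add: proj perp herm_add_right za az herm_self)
  also have "1 + cnj l * ?r - (l * ?r + of_real ((cmod l)\<^sup>2))
      = of_real (1 - (cmod l)\<^sup>2) - 2 * \<i> * of_real (norm a * Im l)"
    by (simp add: complex_eq_iff)
  finally have den: "1 - herm (ball_aut_neg a z) z
      = (of_real (1 - (cmod l)\<^sup>2) - 2 * \<i> * of_real (norm a * Im l)) / (1 - l * ?r)" .
  show ?thesis
    using berezin_transform_ball_aut_neg[of a z] a(1) l nz
    unfolding den by (simp add: z_def)
qed

(* Approaching the boundary point l = 1 along Im l / (1 - |l|^2) = t, the (n+1)-st root of the
   transform tends to (1 - r) / (1 - 2 i r t); t is chosen so that its argument is pi / (n+1). *)
lemma exists_negative_real_part:
  fixes N :: nat and r :: real
  assumes N: "3 \<le> N" and r: "0 < r" "r < 1"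
  shows "\<exists>l. cmod l < 1 \<and>
    Re ((of_real (1 - (cmod l)\<^sup>2) * (1 - l * of_real r)
        / (of_real (1 - (cmod l)\<^sup>2) - 2 * \<i> * of_real (r * Im l))) ^ N) < 0"
proof -
  define \<theta> where "\<theta> = pi / real N"
  \<comment> \<open>The assumption \<open>3 \<le> N\<close> enters here: it keeps the angle
    \<open>pi / N\<close> below a right angle, so that cosine and tangent are positive.\<close>
  have \<theta>: "0 < \<theta>" "\<theta> < pi / 2"
    using N by (simp_all add: \<theta>_def divide_less_cancel field_simps)
  then have cos: "0 < cos \<theta>" and tan: "0 < tan \<theta>"
    by (auto intro: cos_gt_zero tan_gt_zero)
  define t where "t = tan \<theta> / (2 * r)"
  have t: "0 < t"
    using tan r by (simp add: t_def)
  \<comment> \<open>The real part is chosen so that \<open>1 - |l y|^2 = y / t\<close>, as long as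
    the radicand is positive; \<open>l y\<close> tends to 1 as \<open>y\<close> decreases to
    0.\<close>
  define l where "l y = Complex (sqrt (1 - y\<^sup>2 - y / t)) y" for y
  have "((\<lambda>y. 1 - y\<^sup>2 - y / t) \<longlongrightarrow> 1 - 0\<^sup>2 - 0 / t) (at_right 0)"
    using t by (intro tendsto_intros) auto
  then have ev1: "\<forall>\<^sub>F y in at_right 0. 0 < 1 - y\<^sup>2 - y / t"
    by (intro order_tendstoD) auto
  \<comment> \<open>The factor not covered by the choice of angle tends to
    \<open>(1 - r) ^ N > 0\<close>, so its real part is positive for small \<open>y\<close>.\<close>
  have "((\<lambda>y. Re ((1 - l y * of_real r) ^ N)) \<longlongrightarrow>
      Re ((1 - Complex (sqrt (1 - 0\<^sup>2 - 0 / t)) 0 * of_real r) ^ N)) (at_right 0)"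
    unfolding l_def using t by (intro tendsto_intros) auto
  moreover have "0 < Re ((1 - Complex (sqrt (1 - 0\<^sup>2 - 0 / t)) 0 * of_real r) ^ N)"
  proof -
    have "(1 - Complex (sqrt (1 - 0\<^sup>2 - 0 / t)) 0 * of_real r) = of_real (1 - r)"
      by (simp add: complex_eq_iff)
    then show ?thesis
      using r by (simp only: of_real_power[symmetric] Re_complex_of_real) simp
  qed
  ultimately have ev2: "\<forall>\<^sub>F y in at_right 0. 0 < Re ((1 - l y * of_real r) ^ N)"
    by (rule order_tendstoD)
  have "\<forall>\<^sub>F y in at_right 0. (0::real) < y"
    by (rule eventually_at_right_less)
  with ev1 ev2 have "\<forall>\<^sub>F y in at_right 0. 0 < 1 - y\<^sup>2 - y / t \<and> 0 < Re ((1 - l y * of_real r) ^ N) \<and> 0 < y"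
    by eventually_elim auto
  then obtain y where y: "0 < 1 - y\<^sup>2 - y / t" "0 < Re ((1 - l y * of_real r) ^ N)" "0 < y"
    using eventually_happens'[OF trivial_limit_at_right_real] by blast
  have l2: "1 - (cmod (l y))\<^sup>2 = y / t"
    using y(1) by (simp add: l_def cmod_power2)
  then have "(cmod (l y))\<^sup>2 < 1"
    using y(3) t by (metis diff_gt_0_iff_gt divide_pos_pos)
  then have l1: "cmod (l y) < 1"
    by (metis abs_norm_cancel abs_square_less_1)
  have "complex_of_real (y / t) - 2 * \<i> * of_real (r * Im (l y)) = of_real (y / t) * (1 - \<i> * of_real (tan \<theta>))"
    using t r by (simp add: l_def t_def field_simps)
  also have "1 - \<i> * of_real (tan \<theta>) = cis (- \<theta>) / of_real (cos \<theta>)"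
    using cos by (simp add: complex_eq_iff tan_def)
  finally have den: "complex_of_real (y / t) - 2 * \<i> * of_real (r * Im (l y))
      = of_real (y / t) * (cis (- \<theta>) / of_real (cos \<theta>))" .
  have cancel: "Y * X / (Y * (c / C)) = C * inverse c * X" if "Y \<noteq> 0" "C \<noteq> 0" "c \<noteq> 0" for X Y C c :: complex
    using that by (simp add: field_simps)
  have "of_real (1 - (cmod (l y))\<^sup>2) * (1 - l y * of_real r)
        / (of_real (1 - (cmod (l y))\<^sup>2) - 2 * \<i> * of_real (r * Im (l y)))
      = of_real (cos \<theta>) * inverse (cis (- \<theta>)) * (1 - l y * of_real r)"
    unfolding l2 den using y(3) t cos by (intro cancel) simp_all
  also have "inverse (cis (- \<theta>)) = cis \<theta>"
    by simp
  finally have "of_real (1 - (cmod (l y))\<^sup>2) * (1 - l y * of_real r)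
        / (of_real (1 - (cmod (l y))\<^sup>2) - 2 * \<i> * of_real (r * Im (l y)))
      = of_real (cos \<theta>) * cis \<theta> * (1 - l y * of_real r)" .
  then have "(of_real (1 - (cmod (l y))\<^sup>2) * (1 - l y * of_real r)
        / (of_real (1 - (cmod (l y))\<^sup>2) - 2 * \<i> * of_real (r * Im (l y)))) ^ N
      = of_real (cos \<theta> ^ N) * cis (real N * \<theta>) * (1 - l y * of_real r) ^ N"
    by (simp only: power_mult_distrib Complex.DeMoivre of_real_power)
  \<comment> \<open>The power turns the argument \<open>\<theta>\<close> into \<open>pi\<close>,
    that is, into a change of sign.\<close>
  also have "real N * \<theta> = pi"
    using N by (simp add: \<theta>_def)
  finally have "Re ((of_real (1 - (cmod (l y))\<^sup>2) * (1 - l y * of_real r)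
        / (of_real (1 - (cmod (l y))\<^sup>2) - 2 * \<i> * of_real (r * Im (l y)))) ^ N)
      = - (cos \<theta> ^ N * Re ((1 - l y * of_real r) ^ N))"
    by simp
  moreover have "0 < cos \<theta> ^ N * Re ((1 - l y * of_real r) ^ N)"
    using cos y(2) by simp
  ultimately show ?thesis
    using l1 by (intro exI[of _ "l y"]) linarith
qed

section \<open>Convexity of the Berezin range\<close>

theorem theorem3:
  fixes a :: "complex ^ 'n"
  assumes "CARD('n) \<ge> 2"
    and "a \<in> unit_ball"
  shows "convex (berezin_range (composition_operator (ball_aut_neg a))) \<longleftrightarrow> a = 0"
proof
  let ?B = "berezin_transform (composition_operator (ball_aut_neg a))"
  let ?R = "berezin_range (composition_operator (ball_aut_neg a))"
  have a: "norm a < 1"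
    using assms(2) by simp
  have sq: "1 - complex_of_real ((norm z)\<^sup>2) \<noteq> 0" if "norm z < 1" for z :: "complex ^ 'n"
  proof -
    have "(norm z)\<^sup>2 < 1"
      using that by (metis abs_norm_cancel abs_square_less_1)
    then show ?thesis
      by (metis less_irrefl of_real_1 of_real_eq_iff right_minus_eq)
  qed
  {
    assume "a = 0"
    \<comment> \<open>For \<open>a = 0\<close> the automorphism is the identity, so the range is a
      single point.\<close>
    have "?B z = 1" if "norm z < 1" for z
      using sq[OF that] unfolding berezin_transform_ball_aut_neg[OF a that]
      by (simp add: \<open>a = 0\<close> ball_aut_neg_def proj_along_def proj_perp_def herm_self)
    then have "?R \<subseteq> {1}"
      by (auto simp: berezin_range_def)
    then show "convex ?R"
      by (metis convex_empty convex_singleton subset_singletonD)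
  }
  assume conv: "convex ?R"
  show "a = 0"
  proof (rule ccontr)
    assume "a \<noteq> 0"
    define F where "F l = (of_real (1 - (cmod l)\<^sup>2) * (1 - l * of_real (norm a))
        / (of_real (1 - (cmod l)\<^sup>2) - 2 * \<i> * of_real (norm a * Im l))) ^ (CARD('n) + 1)" for l
    have F: "F l \<in> ?R" if "cmod l < 1" for l
    proof -
      have "norm ((l / of_real (norm a)) *s a) < 1"
        using that \<open>a \<noteq> 0\<close> by (simp add: norm_scale_vec norm_divide)
      then show ?thesis
        using berezin_transform_slice[OF a \<open>a \<noteq> 0\<close> that]
        unfolding F_def berezin_range_def by (metis imageI mem_ball_0)
    qed
    obtain l where l: "cmod l < 1" "Re (F l) < 0"
      using exists_negative_real_part[of "CARD('n) + 1" "norm a"] assms(1) a \<open>a \<noteq> 0\<close>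
      unfolding F_def by auto
    \<comment> \<open>Replacing \<open>l\<close> by \<open>cnj l\<close> flips the sign of
      \<open>Im l\<close>, which matches the conjugation of \<open>\<i>\<close> in the denominator;
      all other constants are real.\<close>
    have "F (cnj l) = cnj (F l)"
      by (simp add: F_def)
    then have "cnj (F l) \<in> ?R"
      using F[of "cnj l"] l(1) by simp
    then have "(1 / 2) *\<^sub>R F l + (1 / 2) *\<^sub>R cnj (F l) \<in> ?R"
      using F[OF l(1)] by (intro convexD[OF conv]) auto
    moreover have "(1 / 2) *\<^sub>R F l + (1 / 2) *\<^sub>R cnj (F l) = of_real (Re (F l))"
      by (simp add: complex_eq_iff)
    ultimately have neg: "of_real (Re (F l)) \<in> ?R"
      by simp
    have "F 0 = 1"
      by (simp add: F_def)
    then have one: "1 \<in> ?R"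
      using F[of 0] by simp
    define x where "x = Re (F l)"
    \<comment> \<open>As \<open>x < 0 < 1\<close>, the point 0 lies between \<open>x\<close> and 1;
      these are its weights in that segment.\<close>
    have "(- x / (1 - x)) *\<^sub>R 1 + (1 / (1 - x)) *\<^sub>R complex_of_real x \<in> ?R"
      using l(2) neg one by (intro convexD[OF conv]) (auto simp: x_def field_simps)
    moreover have "(- x / (1 - x)) *\<^sub>R 1 + (1 / (1 - x)) *\<^sub>R complex_of_real x = 0"
      by (simp add: complex_eq_iff)
    ultimately have "0 \<in> ?R"
      by simp
    then obtain z where z: "norm z < 1" "?B z = 0"
      by (auto simp: berezin_range_def)
    \<comment> \<open>Division by zero gives 0, so a zero of the quotient would mean a vanishing
      numerator or a vanishing denominator; both are excluded.\<close>
    then show False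
      using sq[OF z(1)] bergman_inner_kernel_ball_aut_neg(2)[OF a z(1)]
      unfolding berezin_transform_ball_aut_neg[OF a z(1)] by simp
  qed
qed

end
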